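(* No infinite finitely generated group is elementarily equivalent (in the first-order language of groups) to an ultraproduct of a family of finite alternating groups.
   Context: Two groups are elementarily equivalent if they satisfy the same first-order sentences in the language of groups. *)

theory Defs
  imports
    "HOL-Algebra.Sym_Groups"
    "HOL-Algebra.Generated_Groups"
    "HOL-Algebra.Product_Groups"
begin

section \<open>First-order logic in the language of groups\<close>

datatype gterm = Var nat | Unit | Mul gterm gterm | Inv gterm

datatype gform =
    Eq gterm gterm
  | Neg gform
  | Conj gform gform
  | Disj gform gform
  | Impl gform gform
  | All nat gform
  | Ex nat gform

primrec term_vars :: "gterm \<Rightarrow> nat set" where
  "term_vars (Var x) = {x}"
| "term_vars Unit = {}"
| "term_vars (Mul s t) = term_vars s \<union> term_vars t"
| "term_vars (Inv t) = term_vars t"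

primrec free_vars :: "gform \<Rightarrow> nat set" where
  "free_vars (Eq s t) = term_vars s \<union> term_vars t"
| "free_vars (Neg p) = free_vars p"
| "free_vars (Conj p q) = free_vars p \<union> free_vars q"
| "free_vars (Disj p q) = free_vars p \<union> free_vars q"
| "free_vars (Impl p q) = free_vars p \<union> free_vars q"
| "free_vars (All x p) = free_vars p - {x}"
| "free_vars (Ex x p) = free_vars p - {x}"

definition is_sentence :: "gform \<Rightarrow> bool"
  where "is_sentence p \<longleftrightarrow> free_vars p = {}"

primrec term_val :: "('a, 'b) monoid_scheme \<Rightarrow> (nat \<Rightarrow> 'a) \<Rightarrow> gterm \<Rightarrow> 'a" where
  "term_val G e (Var x) = e x"
| "term_val G e Unit = \<one>\<^bsub>G\<^esub>"
| "term_val G e (Mul s t) = term_val G e s \<otimes>\<^bsub>G\<^esub> term_val G e t"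
| "term_val G e (Inv t) = inv\<^bsub>G\<^esub> (term_val G e t)"

primrec sat :: "('a, 'b) monoid_scheme \<Rightarrow> (nat \<Rightarrow> 'a) \<Rightarrow> gform \<Rightarrow> bool" where
  "sat G e (Eq s t) \<longleftrightarrow> term_val G e s = term_val G e t"
| "sat G e (Neg p) \<longleftrightarrow> \<not> sat G e p"
| "sat G e (Conj p q) \<longleftrightarrow> sat G e p \<and> sat G e q"
| "sat G e (Disj p q) \<longleftrightarrow> sat G e p \<or> sat G e q"
| "sat G e (Impl p q) \<longleftrightarrow> (sat G e p \<longrightarrow> sat G e q)"
| "sat G e (All x p) \<longleftrightarrow> (\<forall>a\<in>carrier G. sat G (e(x := a)) p)"
| "sat G e (Ex x p) \<longleftrightarrow> (\<exists>a\<in>carrier G. sat G (e(x := a)) p)"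

lemma term_val_cong:
  "(\<And>x. x \<in> term_vars t \<Longrightarrow> e x = e' x) \<Longrightarrow> term_val G e t = term_val G e' t"
  by (induction t) auto

lemma sat_cong:
  "(\<And>x. x \<in> free_vars p \<Longrightarrow> e x = e' x) \<Longrightarrow> sat G e p = sat G e' p"
proof (induction p arbitrary: e e')
  case (Eq s t)
  then show ?case
    using term_val_cong[of s e e' G] term_val_cong[of t e e' G] by auto
next
  case (Neg p)
  show ?case using Neg.prems Neg.IH[of e e'] by simp
next
  case (Conj p q)
  show ?case using Conj.prems Conj.IH(1)[of e e'] Conj.IH(2)[of e e'] by simp
next
  case (Disj p q)
  show ?case using Disj.prems Disj.IH(1)[of e e'] Disj.IH(2)[of e e'] by simp
next
  case (Impl p q)
  show ?case using Impl.prems Impl.IH(1)[of e e'] Impl.IH(2)[of e e'] by simp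
next
  case (All x p)
  have "sat G (e(x := a)) p = sat G (e'(x := a)) p" for a
    by (rule All.IH) (use All.prems in auto)
  then show ?case by simp
next
  case (Ex x p)
  have "sat G (e(x := a)) p = sat G (e'(x := a)) p" for a
    by (rule Ex.IH) (use Ex.prems in auto)
  then show ?case by simp
qed

text \<open>
  The truth value of a sentence does not depend on the assignment (\<open>sat_cong\<close>), so the
  assignment that is constantly the identity element is as good as any other.
\<close>

definition models :: "('a, 'b) monoid_scheme \<Rightarrow> gform \<Rightarrow> bool"
  where "models G p \<longleftrightarrow> sat G (\<lambda>_. \<one>\<^bsub>G\<^esub>) p"

definition elementarily_equivalent ::
    "('a, 'b) monoid_scheme \<Rightarrow> ('c, 'd) monoid_scheme \<Rightarrow> bool"
  where "elementarily_equivalent G H \<longleftrightarrow> (\<forall>p. is_sentence p \<longrightarrow> (models G p \<longleftrightarrow> models H p))"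


section \<open>Finitely generated groups\<close>

definition finitely_generated :: "('a, 'b) monoid_scheme \<Rightarrow> bool"
  where "finitely_generated G \<longleftrightarrow>
    (\<exists>S. finite S \<and> S \<subseteq> carrier G \<and> generate G S = carrier G)"


section \<open>Ultraproducts of groups\<close>

text \<open>
  An ultrafilter on the set \<open>I\<close> is a filter on the ambient type that is concentrated on \<open>I\<close>.
  Principal ultrafilters are not excluded.
\<close>

definition ultrafilter_on :: "'i set \<Rightarrow> 'i filter \<Rightarrow> bool"
  where "ultrafilter_on I U \<longleftrightarrow>
    U \<noteq> bot \<and> U \<le> principal I \<and>
    (\<forall>P. eventually P U \<or> eventually (\<lambda>i. \<not> P i) U)"

definition ultra_kernel ::
    "'i set \<Rightarrow> 'i filter \<Rightarrow> ('i \<Rightarrow> ('a, 'b) monoid_scheme) \<Rightarrow> ('i \<Rightarrow> 'a) set"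
  where "ultra_kernel I U G =
    {f \<in> carrier (product_group I G). eventually (\<lambda>i. f i = \<one>\<^bsub>G i\<^esub>) U}"

definition ultraproduct ::
    "'i set \<Rightarrow> 'i filter \<Rightarrow> ('i \<Rightarrow> ('a, 'b) monoid_scheme) \<Rightarrow> ('i \<Rightarrow> 'a) set monoid"
  where "ultraproduct I U G = product_group I G Mod ultra_kernel I U G"

lemma ultra_kernel_normal:
  assumes G: "\<And>i. i \<in> I \<Longrightarrow> group (G i)" and U: "U \<le> principal I"
  shows "ultra_kernel I U G \<lhd> product_group I G"
proof -
  interpret P: group "product_group I G"
    using G by simp
  have ev_I: "eventually (\<lambda>i. i \<in> I) U"
    using U by (simp add: le_principal)
  note defs = ultra_kernel_def
  have sub: "subgroup (ultra_kernel I U G) (product_group I G)"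
  proof (rule P.subgroupI)
    show "ultra_kernel I U G \<subseteq> carrier (product_group I G)"
      by (auto simp: defs)
    have "\<one>\<^bsub>product_group I G\<^esub> \<in> ultra_kernel I U G"
      using P.one_closed ev_I by (auto simp: defs elim: eventually_mono)
    then show "ultra_kernel I U G \<noteq> {}" by blast
  next
    fix f assume f: "f \<in> ultra_kernel I U G"
    then have fc: "f \<in> carrier (product_group I G)"
      and ev: "eventually (\<lambda>i. f i = \<one>\<^bsub>G i\<^esub>) U"
      by (auto simp: defs)
    have "eventually (\<lambda>i. (inv\<^bsub>product_group I G\<^esub> f) i = \<one>\<^bsub>G i\<^esub>) U"
      using ev ev_I
      by eventually_elim (use fc G in \<open>simp add: inv_product_group group.is_monoid monoid.inv_one\<close>)
    then show "inv\<^bsub>product_group I G\<^esub> f \<in> ultra_kernel I U G"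
      using P.inv_closed[OF fc] by (simp add: defs)
  next
    fix f g assume f: "f \<in> ultra_kernel I U G" and g: "g \<in> ultra_kernel I U G"
    then have fg: "f \<in> carrier (product_group I G)" "g \<in> carrier (product_group I G)"
      and ev: "eventually (\<lambda>i. f i = \<one>\<^bsub>G i\<^esub>) U" "eventually (\<lambda>i. g i = \<one>\<^bsub>G i\<^esub>) U"
      by (auto simp: defs)
    have "eventually (\<lambda>i. (f \<otimes>\<^bsub>product_group I G\<^esub> g) i = \<one>\<^bsub>G i\<^esub>) U"
      using ev ev_I by eventually_elim (use G in \<open>simp add: group.is_monoid\<close>)
    then show "f \<otimes>\<^bsub>product_group I G\<^esub> g \<in> ultra_kernel I U G"
      using P.m_closed[OF fg] by (simp add: defs)
  qed
  have "x \<otimes>\<^bsub>product_group I G\<^esub> h \<otimes>\<^bsub>product_group I G\<^esub> inv\<^bsub>product_group I G\<^esub> x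
          \<in> ultra_kernel I U G" (is "?c \<in> _")
    if x: "x \<in> carrier (product_group I G)" and h: "h \<in> ultra_kernel I U G" for x h
  proof -
    have hc: "h \<in> carrier (product_group I G)"
      and ev: "eventually (\<lambda>i. h i = \<one>\<^bsub>G i\<^esub>) U"
      using h by (auto simp: defs)
    have "eventually (\<lambda>i. ?c i = \<one>\<^bsub>G i\<^esub>) U"
      using ev ev_I
    proof eventually_elim
      case (elim i)
      interpret Gi: group "G i" using G elim by simp
      have "x i \<in> carrier (G i)" using x elim by auto
      then show ?case using elim x G by simp
    qed
    then show ?thesis
      using P.m_closed[OF P.m_closed[OF x hc] P.inv_closed[OF x]] by (simp add: defs)
  qed
  with sub show ?thesis by (simp add: P.normal_inv_iff)
qed

lemma ultraproduct_is_group: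
  assumes "\<And>i. i \<in> I \<Longrightarrow> group (G i)" and "ultrafilter_on I U"
  shows "group (ultraproduct I U G)"
  using assms ultra_kernel_normal[of I G U]
  by (auto simp: ultraproduct_def ultrafilter_on_def intro: normal.factorgroup_is_group)

end

(*
  The proof rests on a sentence that holds in all alternating groups and forces finitely generated
  groups to be finite. In Alt(n) the points 1, ..., n and their subsets are interpretable: points
  are cosets of a point stabilizer, which is definable, and subsets are supports of elements.
  For every choice of g_1, ..., g_d the Schreier graph of these elements on the points can be
  enumerated by distance from a root, component by component. If S_y denotes the set of points
  up to y in this enumeration and y, y' are adjacent, then S_y lies in the 2-neighbourhood of S_y'
  up to two exceptional points. The existence of such an enumeration, with a first and a last
  point, is a first-order property of Alt(n); by Los's theorem it passes to ultraproducts.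
  In a group generated by g_1, ..., g_d every y is reached from the first point in finitely many
  steps, so S_y is finite for every y. Taking y to be the last point, the group acts faithfully on a
  finite set and is therefore finite. Small n are covered by a disjunct bounding the order.
*)

theory Submission
  imports Defs
begin

section \<open>Ultraproducts\<close>

text \<open>Finite generation replaces it by induction over words in the generators; the
  neighbourhood condition is the rule that carries finiteness from one point to an adjacent one.
  That given elements generate the group is not expressible either. Hence the sentence speaks of all
  d-tuples, whose graph on the points may be disconnected in Alt(n); this is why the enumeration
  goes component by component. The stabilizer is encoded as the normalizer of a definable set, so it
  is a subgroup in every group and for all parameters, and no clause of the sentence has to ensure
  this. The radius 2 pays for one layer between neighbours and for the arbitrary order inside a
  layer. Definability of the stabilizer is shown for n at least 13 = 1 + 4 * 3, which makes room for
  four involutions that share one moved point and move three further points each.\<close>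

lemma term_val_carrier:
  assumes "group G" "\<And>x. e x \<in> carrier G"
  shows "term_val G e t \<in> carrier G"
proof -
  interpret group G by fact
  show ?thesis by (induction t) (simp_all add: assms)
qed

lemma term_val_product_group:
  assumes "\<And>i. i \<in> I \<Longrightarrow> group (G i)" "i \<in> I" "\<And>x. e x \<in> carrier (product_group I G)"
  shows "term_val (product_group I G) e t i = term_val (G i) (\<lambda>x. e x i) t"
proof (induction t)
  case (Inv t)
  have "term_val (product_group I G) e t \<in> carrier (product_group I G)"
    using assms by (intro term_val_carrier) auto
  then show ?case using Inv assms by simp
qed (use assms in auto)

lemma (in normal) term_val_FactGroup:
  assumes "\<And>x. e x \<in> carrier G"
  shows "term_val (G Mod H) (\<lambda>x. H #> e x) t = H #> term_val G e t"
proof (induction t)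
  case (Inv t)
  have *: "term_val G e t \<in> carrier G" using assms is_group by (intro term_val_carrier) auto
  then have "H #> term_val G e t \<in> carrier (G Mod H)"
    by (auto simp: FactGroup_def RCOSETS_def)
  then show ?case using Inv * by (simp add: inv_FactGroup rcos_inv)
next
  case (Mul s t)
  have *: "term_val G e t \<in> carrier G" for t
    using assms is_group by (intro term_val_carrier) auto
  show ?case using Mul by (simp add: rcos_sum *)
next
  case Unit
  have "H #> \<one> = H" by (simp add: subset)
  then show ?case by simp
qed simp

lemma (in subgroup) rcos_eq_iff:
  assumes "group G" "x \<in> carrier G" "y \<in> carrier G"
  shows "H #> x = H #> y \<longleftrightarrow> x \<otimes> inv y \<in> H"
proof
  assume "H #> x = H #> y"
  then have "x \<in> H #> y"
    using group.rcos_self[OF assms(1,2) subgroup_axioms] by simp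
  then show "x \<otimes> inv y \<in> H" using rcos_module[OF assms(1,3,2)] by simp
next
  assume "x \<otimes> inv y \<in> H"
  then have "x \<in> H #> y" using rcos_module[OF assms(1,3,2)] by simp
  then show "H #> x = H #> y"
    using group.repr_independence[OF assms(1) _ assms(3) subgroup_axioms] by simp
qed

section \<open>Ultrafilters and Los's theorem\<close>

lemma eventually_Not_ultrafilter_on:
  assumes "ultrafilter_on I U"
  shows "eventually (\<lambda>i. \<not> P i) U \<longleftrightarrow> \<not> eventually P U"
proof
  assume "eventually (\<lambda>i. \<not> P i) U"
  show "\<not> eventually P U"
  proof
    assume "eventually P U"
    with \<open>eventually (\<lambda>i. \<not> P i) U\<close> have "eventually (\<lambda>i. False) U"
      by eventually_elim simp
    with assms show False by (simp add: ultrafilter_on_def)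
  qed
qed (use assms in \<open>auto simp: ultrafilter_on_def\<close>)

lemma eventually_disj_ultrafilter_on:
  assumes "ultrafilter_on I U"
  shows "eventually (\<lambda>i. P i \<or> Q i) U \<longleftrightarrow> eventually P U \<or> eventually Q U"
proof -
  have "eventually (\<lambda>i. \<not> (P i \<or> Q i)) U \<longleftrightarrow>
      eventually (\<lambda>i. \<not> P i) U \<and> eventually (\<lambda>i. \<not> Q i) U"
    by (simp add: eventually_conj_iff)
  then show ?thesis by (simp only: eventually_Not_ultrafilter_on[OF assms]) blast
qed

text \<open>The quantifier step of Los's theorem. Witnesses are chosen coordinatewise, and the
  identity fills the coordinates without one, so that the choice is an element of the
  product.\<close>

lemma eventually_bex_ultrafilter_on:
  assumes U: "ultrafilter_on I U" and G: "\<And>i. i \<in> I \<Longrightarrow> group (G i)"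
  shows "(\<exists>f\<in>carrier (product_group I G). eventually (\<lambda>i. P i (f i)) U) \<longleftrightarrow>
    eventually (\<lambda>i. \<exists>a\<in>carrier (G i). P i a) U"
proof
  have I: "eventually (\<lambda>i. i \<in> I) U"
    using U by (simp add: ultrafilter_on_def le_principal)
  {
    assume "\<exists>f\<in>carrier (product_group I G). eventually (\<lambda>i. P i (f i)) U"
    then obtain f where f: "f \<in> carrier (product_group I G)" "eventually (\<lambda>i. P i (f i)) U"
      by blast
    show "eventually (\<lambda>i. \<exists>a\<in>carrier (G i). P i a) U"
      using f(2) I by eventually_elim (use f(1) in auto)
  next
    assume *: "eventually (\<lambda>i. \<exists>a\<in>carrier (G i). P i a) U"
    define f where
      "f = (\<lambda>i\<in>I. if \<exists>a\<in>carrier (G i). P i a then SOME a. a \<in> carrier (G i) \<and> P i a else \<one>\<^bsub>G i\<^esub>)"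
    have f_some: "f i \<in> carrier (G i) \<and> P i (f i)" if "i \<in> I" "\<exists>a\<in>carrier (G i). P i a" for i
      using that someI_ex[of "\<lambda>a. a \<in> carrier (G i) \<and> P i a"] by (auto simp: f_def)
    have "f \<in> carrier (product_group I G)"
    proof -
      have "f i \<in> carrier (G i)" if "i \<in> I" for i
        using f_some that G[OF that]
        by (cases "\<exists>a\<in>carrier (G i). P i a") (auto simp: f_def group.is_monoid)
      then show ?thesis by (auto simp: f_def)
    qed
    moreover have "eventually (\<lambda>i. P i (f i)) U"
      using * I by eventually_elim (use f_some in blast)
    ultimately show "\<exists>f\<in>carrier (product_group I G). eventually (\<lambda>i. P i (f i)) U" by blast
  }
qed

theorem Los:
  fixes G :: "'i \<Rightarrow> ('a, 'b) monoid_scheme"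
  assumes G: "\<And>i. i \<in> I \<Longrightarrow> group (G i)" and U: "ultrafilter_on I U"
    and e: "\<And>x. e x \<in> carrier (product_group I G)"
  shows "sat (ultraproduct I U G) (\<lambda>x. ultra_kernel I U G #>\<^bsub>product_group I G\<^esub> e x) p \<longleftrightarrow>
    eventually (\<lambda>i. sat (G i) (\<lambda>x. e x i) p) U"
  using e
proof (induction p arbitrary: e)
  let ?P = "product_group I G" and ?K = "ultra_kernel I U G"
  have I: "eventually (\<lambda>i. i \<in> I) U"
    using U by (simp add: ultrafilter_on_def le_principal)
  interpret P: group ?P using G by simp
  interpret K: normal ?K ?P
    using U G by (intro ultra_kernel_normal) (auto simp: ultrafilter_on_def)
  have carrier: "carrier (ultraproduct I U G) = (\<lambda>f. ?K #>\<^bsub>?P\<^esub> f) ` carrier ?P"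
    by (auto simp: ultraproduct_def FactGroup_def RCOSETS_def)
  {
    case (Eq s t)
    have tv: "term_val ?P e u \<in> carrier ?P" for u
      using Eq G by (intro term_val_carrier) auto
    \<comment> \<open>Equality of cosets means that the quotient lies in the kernel, that is, equals
      the identity on a large set of coordinates.\<close>
    have "sat (ultraproduct I U G) (\<lambda>x. ?K #>\<^bsub>?P\<^esub> e x) (Eq s t) \<longleftrightarrow>
        term_val ?P e s \<otimes>\<^bsub>?P\<^esub> inv\<^bsub>?P\<^esub> term_val ?P e t \<in> ?K"
      using Eq tv[of s] tv[of t]
      by (simp add: ultraproduct_def K.term_val_FactGroup K.rcos_eq_iff[OF P.is_group]
            del: carrier_product_group mult_product_group inv_product_group)
    also have "\<dots> \<longleftrightarrow> eventually (\<lambda>i. (term_val ?P e s \<otimes>\<^bsub>?P\<^esub> inv\<^bsub>?P\<^esub> term_val ?P e t) i = \<one>\<^bsub>G i\<^esub>) U"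
      using P.m_closed[OF tv[of s] P.inv_closed[OF tv[of t]]] by (simp add: ultra_kernel_def)
    also have "\<dots> \<longleftrightarrow> eventually (\<lambda>i. term_val (G i) (\<lambda>x. e x i) s = term_val (G i) (\<lambda>x. e x i) t) U"
    proof (rule eventually_cong[OF I])
      fix i assume i: "i \<in> I"
      interpret Gi: group "G i" using G i .
      have "term_val (G i) (\<lambda>x. e x i) u \<in> carrier (G i)" for u
        using Eq i by (intro term_val_carrier) (auto simp: PiE_iff)
      moreover have "term_val ?P e u i = term_val (G i) (\<lambda>x. e x i) u" for u
        using Eq i G by (intro term_val_product_group) auto
      ultimately show "(term_val ?P e s \<otimes>\<^bsub>?P\<^esub> inv\<^bsub>?P\<^esub> term_val ?P e t) i = \<one>\<^bsub>G i\<^esub> \<longleftrightarrow>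
          term_val (G i) (\<lambda>x. e x i) s = term_val (G i) (\<lambda>x. e x i) t"
        using i tv[of t] G Gi.inv_solve_right'[of "\<one>\<^bsub>G i\<^esub>"] by simp
    qed
    finally show ?case by simp
  next
    case (Neg p)
    then show ?case by (simp add: eventually_Not_ultrafilter_on[OF U])
  next
    case (Conj p q)
    then show ?case by (simp add: eventually_conj_iff)
  next
    case (Disj p q)
    then show ?case by (simp add: eventually_disj_ultrafilter_on[OF U])
  next
    case (Impl p q)
    have "eventually (\<lambda>i. P i \<longrightarrow> Q i) U \<longleftrightarrow> (eventually P U \<longrightarrow> eventually Q U)" for P Q
      using eventually_disj_ultrafilter_on[OF U, of "\<lambda>i. \<not> P i" Q]
      by (simp add: eventually_Not_ultrafilter_on[OF U])
    with Impl show ?case by simp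
  next
    case (Ex x p)
    have IH: "sat (ultraproduct I U G) ((\<lambda>y. ?K #>\<^bsub>?P\<^esub> e y)(x := ?K #>\<^bsub>?P\<^esub> f)) p \<longleftrightarrow>
        eventually (\<lambda>i. sat (G i) ((\<lambda>y. e y i)(x := f i)) p) U" if "f \<in> carrier ?P" for f
    proof -
      have "(\<lambda>y. ?K #>\<^bsub>?P\<^esub> e y)(x := ?K #>\<^bsub>?P\<^esub> f) = (\<lambda>y. ?K #>\<^bsub>?P\<^esub> (e(x := f)) y)"
        "\<And>i. (\<lambda>y. e y i)(x := f i) = (\<lambda>y. (e(x := f)) y i)"
        by (auto simp: fun_eq_iff)
      then show ?thesis using Ex.IH[of "e(x := f)"] Ex.prems that
        by (simp del: carrier_product_group)
    qed
    have "sat (ultraproduct I U G) (\<lambda>y. ?K #>\<^bsub>?P\<^esub> e y) (Ex x p) \<longleftrightarrow>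
        (\<exists>f\<in>carrier ?P. eventually (\<lambda>i. sat (G i) ((\<lambda>y. e y i)(x := f i)) p) U)"
      using IH by (auto simp: carrier simp del: carrier_product_group)
    also have "\<dots> \<longleftrightarrow> eventually (\<lambda>i. \<exists>a\<in>carrier (G i). sat (G i) ((\<lambda>y. e y i)(x := a)) p) U"
      by (rule eventually_bex_ultrafilter_on[OF U G])
    finally show ?case by simp
  next
    case (All x p)
    have IH: "sat (ultraproduct I U G) ((\<lambda>y. ?K #>\<^bsub>?P\<^esub> e y)(x := ?K #>\<^bsub>?P\<^esub> f)) p \<longleftrightarrow>
        eventually (\<lambda>i. sat (G i) ((\<lambda>y. e y i)(x := f i)) p) U" if "f \<in> carrier ?P" for f
    proof -
      have "(\<lambda>y. ?K #>\<^bsub>?P\<^esub> e y)(x := ?K #>\<^bsub>?P\<^esub> f) = (\<lambda>y. ?K #>\<^bsub>?P\<^esub> (e(x := f)) y)"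
        "\<And>i. (\<lambda>y. e y i)(x := f i) = (\<lambda>y. (e(x := f)) y i)"
        by (auto simp: fun_eq_iff)
      then show ?thesis using All.IH[of "e(x := f)"] All.prems that
        by (simp del: carrier_product_group)
    qed
    \<comment> \<open>Dual to the existential case; the negation passes through
      \<open>eventually\<close> because \<open>U\<close> is an ultrafilter.\<close>
    have "sat (ultraproduct I U G) (\<lambda>y. ?K #>\<^bsub>?P\<^esub> e y) (All x p) \<longleftrightarrow>
        \<not> (\<exists>f\<in>carrier ?P. eventually (\<lambda>i. \<not> sat (G i) ((\<lambda>y. e y i)(x := f i)) p) U)"
      using IH by (auto simp: carrier eventually_Not_ultrafilter_on[OF U] simp del: carrier_product_group)
    also have "\<dots> \<longleftrightarrow> \<not> eventually (\<lambda>i. \<exists>a\<in>carrier (G i). \<not> sat (G i) ((\<lambda>y. e y i)(x := a)) p) U"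
      by (subst eventually_bex_ultrafilter_on[OF U G]) auto
    also have "\<dots> \<longleftrightarrow> eventually (\<lambda>i. \<forall>a\<in>carrier (G i). sat (G i) ((\<lambda>y. e y i)(x := a)) p) U"
      by (subst eventually_Not_ultrafilter_on[OF U, symmetric]) simp
    finally show ?case by simp
  }
qed

corollary models_ultraproduct:
  fixes G :: "'i \<Rightarrow> ('a, 'b) monoid_scheme"
  assumes "\<And>i. i \<in> I \<Longrightarrow> group (G i)" "ultrafilter_on I U" "\<And>i. i \<in> I \<Longrightarrow> models (G i) p"
    "is_sentence p"
  shows "models (ultraproduct I U G) p"
proof -
  let ?P = "product_group I G"
  interpret P: group ?P using assms by simp
  have "eventually (\<lambda>i. i \<in> I) U"
    using assms by (simp add: ultrafilter_on_def le_principal)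
  then have "eventually (\<lambda>i. sat (G i) (\<lambda>_. \<one>\<^bsub>?P\<^esub> i) p) U"
    by eventually_elim (use assms in \<open>simp add: models_def\<close>)
  then have "sat (ultraproduct I U G) (\<lambda>_. ultra_kernel I U G #>\<^bsub>?P\<^esub> \<one>\<^bsub>?P\<^esub>) p"
    using Los[OF assms(1,2), where e = "\<lambda>_. \<one>\<^bsub>?P\<^esub>"] P.one_closed by simp
  moreover have "sat H e p \<longleftrightarrow> sat H e' p" for e e' and H :: "('i \<Rightarrow> 'a) set monoid"
    using assms(4) by (intro sat_cong) (simp add: is_sentence_def)
  ultimately show ?thesis unfolding models_def by metis
qed

section \<open>Even permutations\<close>

lemma permutes_extend:
  assumes "finite S" "A \<subseteq> S" "inj_on f A" "f ` A \<subseteq> S"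
  obtains p where "p permutes S" "\<And>x. x \<in> A \<Longrightarrow> p x = f x"
proof -
  have "card (S - A) = card (S - f ` A)"
    using assms by (simp add: card_Diff_subset card_image finite_subset)
  then obtain g where g: "bij_betw g (S - A) (S - f ` A)"
    using assms(1) by (meson finite_Diff finite_same_card_bij)
  let ?h = "\<lambda>x. if x \<in> A then f x else g x"
  define p where "p = (\<lambda>x. if x \<in> S then ?h x else x)"
  have "bij_betw ?h (A \<union> (S - A)) (f ` A \<union> (S - f ` A))"
  proof (rule bij_betw_disjoint_Un)
    show "bij_betw f A (f ` A)" using assms(3) by (simp add: bij_betw_def)
  qed (use g in auto)
  moreover have "A \<union> (S - A) = S" "f ` A \<union> (S - f ` A) = S"
    using assms by auto
  ultimately have "bij_betw ?h S S" by (simp only:)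
  then have "bij_betw p S S"
    by (rule bij_betw_cong[THEN iffD1, rotated]) (simp add: p_def)
  then have "p permutes S" by (rule bij_imp_permutes) (simp add: p_def)
  moreover have "p x = f x" if "x \<in> A" for x using that assms by (auto simp: p_def)
  ultimately show ?thesis using that by blast
qed

text \<open>A wrong parity is repaired by a transposition of two points outside \<open>A\<close>,
  applied before the extension; the 2 in the bound provides these points.\<close>

lemma permutes_evenperm_extend:
  assumes "finite S" "A \<subseteq> S" "inj_on f A" "f ` A \<subseteq> S" "card A + 2 \<le> card S"
  obtains p where "p permutes S" "evenperm p" "\<And>x. x \<in> A \<Longrightarrow> p x = f x"
proof -
  obtain p where p: "p permutes S" "\<And>x. x \<in> A \<Longrightarrow> p x = f x"
    using permutes_extend[OF assms(1-4)] by blast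
  show ?thesis
  proof (cases "evenperm p")
    case False
    have "2 \<le> card (S - A)" using assms by (simp add: card_Diff_subset finite_subset)
    then obtain T where "T \<subseteq> S - A" "card T = 2" by (meson obtain_subset_with_card_n)
    then obtain u v where uv: "u \<noteq> v" "u \<in> S - A" "v \<in> S - A" by (auto simp: card_2_iff)
    have "permutation p" using p(1) assms(1) by (auto simp: permutation_permutes)
    then have "evenperm (p \<circ> transpose u v)"
      using False uv by (simp add: evenperm_comp permutation_swap_id evenperm_swap)
    moreover have "p \<circ> transpose u v permutes S"
      using p(1) uv by (intro permutes_compose permutes_swap_id) auto
    moreover have "(p \<circ> transpose u v) x = f x" if "x \<in> A" for x
      using that uv p(2) by (auto simp: transpose_def)
    ultimately show ?thesis using that by blast
  qed (use that p in blast)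
qed

section \<open>Three-cycles and supports of even permutations\<close>

definition three_cycle :: "'a \<Rightarrow> 'a \<Rightarrow> 'a \<Rightarrow> 'a \<Rightarrow> 'a" where
  "three_cycle i j k = transpose i j \<circ> transpose j k"

lemma three_cycle_apply:
  assumes "i \<noteq> j" "i \<noteq> k" "j \<noteq> k"
  shows "three_cycle i j k x = (if x = i then j else if x = j then k else if x = k then i else x)"
  using assms by (auto simp: three_cycle_def transpose_def)

lemma evenperm_transpose_comp:
  assumes "a \<noteq> b" "c \<noteq> d"
  shows "evenperm (transpose a b \<circ> transpose c d)"
  using assms by (simp add: evenperm_comp permutation_swap_id evenperm_swap)

lemma evenperm_three_cycle:
  assumes "i \<noteq> j" "i \<noteq> k" "j \<noteq> k"
  shows "evenperm (three_cycle i j k)"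
  using assms by (simp add: three_cycle_def evenperm_transpose_comp)

lemma permutes_three_cycle:
  assumes "i \<in> S" "j \<in> S" "k \<in> S"
  shows "three_cycle i j k permutes S"
  unfolding three_cycle_def using assms by (intro permutes_compose permutes_swap_id) auto

lemma conjugate_three_cycle:
  assumes "bij h" "i \<noteq> j" "i \<noteq> k" "j \<noteq> k"
  shows "h \<circ> three_cycle i j k \<circ> inv' h = three_cycle (h i) (h j) (h k)"
proof
  fix x
  have "inj h" "surj h" using assms(1) by (auto simp: bij_def)
  moreover obtain y where "x = h y" using \<open>surj h\<close> by (meson surjD)
  ultimately show "(h \<circ> three_cycle i j k \<circ> inv' h) x = three_cycle (h i) (h j) (h k) x"
    using assms by (simp add: three_cycle_apply inj_eq)
qed

text \<open>A permutation that commutes with the cycle acts on its support as a power of the cycle,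
  and the identity is the only power whose square is trivial. Thus a commutation equation detects
  whether a 3-cycle and an involution have disjoint supports.\<close>

lemma three_cycle_commute_iff:
  assumes "i \<noteq> j" "i \<noteq> k" "j \<noteq> k" "\<And>x. b (b x) = x"
  shows "three_cycle i j k \<circ> b = b \<circ> three_cycle i j k \<longleftrightarrow> b i = i \<and> b j = j \<and> b k = k"
    (is "?x \<circ> b = b \<circ> ?x \<longleftrightarrow> _")
proof
  assume "?x \<circ> b = b \<circ> ?x"
  then have "?x (b z) = b (?x z)" for z by (metis comp_apply)
  from this[of i] this[of j] this[of k]
  have x: "?x (b i) = b j" "?x (b j) = b k" "?x (b k) = b i"
    using assms(1-3) by (auto simp: three_cycle_apply)
  have "b i \<noteq> b j" using assms(1,4) by metis
  then have "b i \<in> {i, j, k}" using x(1) assms(1-3) by (auto simp: three_cycle_apply split: if_splits)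
  moreover have "b i \<noteq> j"
  proof
    assume "b i = j"
    then have "b j = i" using assms(4) by metis
    with \<open>b i = j\<close> x(1) show False using assms(1-3) by (simp add: three_cycle_apply)
  qed
  moreover have "b i \<noteq> k"
  proof
    assume "b i = k"
    then have "b k = i" using assms(4) by metis
    with \<open>b i = k\<close> x(3) show False using assms(1-3) by (simp add: three_cycle_apply)
  qed
  ultimately have "b i = i" by simp
  with x show "b i = i \<and> b j = j \<and> b k = k"
    using assms(1-3) by (simp add: three_cycle_apply)
next
  assume *: "b i = i \<and> b j = j \<and> b k = k"
  moreover have "b z = w \<longleftrightarrow> z = w" if "b w = w" for z w
    using assms(4)[of z] that by auto
  ultimately have "b z = i \<longleftrightarrow> z = i" "b z = j \<longleftrightarrow> z = j" "b z = k \<longleftrightarrow> z = k" for z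
    by simp_all
  then show "?x \<circ> b = b \<circ> ?x"
    using assms(1-3) by (simp add: fun_eq_iff three_cycle_apply *)
qed

text \<open>Three and four points carry a 3-cycle and a product of two transpositions; larger sets
  are reduced by two points at a time, which keeps the parity. Two points support only an odd
  permutation, hence the bound.\<close>

lemma evenperm_with_support:
  assumes "finite T" "card T \<ge> 3"
  obtains t where "t permutes T" "evenperm t" "\<And>x. x \<in> T \<Longrightarrow> t x \<noteq> x"
proof -
  have "\<exists>t. t permutes T \<and> evenperm t \<and> (\<forall>x\<in>T. t x \<noteq> x)"
    using assms
  proof (induction "card T" arbitrary: T rule: less_induct)
    case less
    consider "card T = 3" | "card T = 4" | "card T \<ge> 5" using less.prems by linarith
    then show ?case
    proof cases
      case 1
      then obtain i j k where T: "T = {i, j, k}" "i \<noteq> j" "i \<noteq> k" "j \<noteq> k"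
        by (auto simp: card_3_iff)
      then show ?thesis
        by (intro exI[of _ "three_cycle i j k"])
           (auto simp: permutes_three_cycle evenperm_three_cycle three_cycle_apply)
    next
      case 2
      then obtain i T' where T': "T = insert i T'" "i \<notin> T'" "card T' = 3"
        using card_Suc_eq[of T 3] by auto
      then obtain j k l where T: "T' = {j, k, l}" "j \<noteq> k" "j \<noteq> l" "k \<noteq> l"
        by (auto simp: card_3_iff)
      let ?t = "transpose i j \<circ> transpose k l"
      have "?t permutes T"
        using T' T by (intro permutes_compose permutes_swap_id) auto
      moreover have "evenperm ?t" using T' T by (intro evenperm_transpose_comp) auto
      moreover have "\<forall>x\<in>T. ?t x \<noteq> x" using T' T by (auto simp: transpose_def)
      ultimately show ?thesis by blast
    next
      case 3
      obtain W where "W \<subseteq> T" "card W = 2"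
        using 3 obtain_subset_with_card_n[of 2 T] by auto
      then obtain u v where uv: "u \<noteq> v" "u \<in> T" "v \<in> T" by (auto simp: card_2_iff)
      have card: "card (T - {u, v}) = card T - 2" using uv less.prems by (simp add: card_Diff_subset)
      then have "card (T - {u, v}) < card T" "3 \<le> card (T - {u, v})" using 3 by simp_all
      then obtain t where t: "t permutes T - {u, v}" "evenperm t" "\<And>x. x \<in> T - {u, v} \<Longrightarrow> t x \<noteq> x"
        using less.hyps[of "T - {u, v}"] less.prems(1) by blast
      have "T - {u, v} \<noteq> {}" using \<open>3 \<le> card (T - {u, v})\<close> by force
      then obtain z where z: "z \<in> T" "z \<noteq> u" "z \<noteq> v" by blast
      \<comment> \<open>This inserts \<open>u\<close> and \<open>v\<close> into the cycle of
        \<open>t\<close> through \<open>z\<close>, directly after \<open>z\<close>, so no fixed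
        point arises.\<close>
      let ?t = "t \<circ> three_cycle z u v"
      have t_uv: "t u = u" "t v = v" using t(1) by (auto simp: permutes_not_in)
      have t_in: "t x \<in> T - {u, v} \<longleftrightarrow> x \<in> T - {u, v}" for x
        using t(1) by (rule permutes_in_image)
      have "?t permutes T"
        using z uv t(1) by (intro permutes_compose permutes_three_cycle permutes_subset[OF t(1)]) auto
      moreover have "evenperm ?t"
      proof -
        have "permutation t" using t(1) less.prems(1) by (auto simp: permutation_permutes)
        moreover have "permutation (three_cycle z u v)"
          using permutes_three_cycle[of z T u v] z uv less.prems(1)
          by (auto simp: permutation_permutes)
        ultimately show ?thesis using t(2) z uv by (simp add: evenperm_comp evenperm_three_cycle)
      qed
      moreover have "?t x \<noteq> x" if "x \<in> T" for x
        using that z uv t(3)[of x] t_uv t_in[of z] by (auto simp: three_cycle_apply)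
      ultimately show ?thesis by blast
    qed
  qed
  then show ?thesis using that by blast
qed

section \<open>Layered enumerations of a finite graph\<close>

lemma sorted_enumeration:
  fixes V :: "nat set" and g :: "nat \<Rightarrow> nat"
  assumes "finite V"
  obtains e where "bij_betw e {..<card V} V" "\<And>i j. i \<le> j \<Longrightarrow> j < card V \<Longrightarrow> g (e i) \<le> g (e j)"
proof -
  define xs where "xs = sort_key g (sorted_list_of_set V)"
  have xs: "distinct xs" "set xs = V" "sorted (map g xs)" "length xs = card V"
    using assms by (auto simp: xs_def)
  then have "bij_betw ((!) xs) {..<card V} V" by (simp add: bij_betw_nth)
  moreover have "g (xs ! i) \<le> g (xs ! j)" if "i \<le> j" "j < card V" for i j
    using sorted_nth_mono[OF xs(3) that(1)] that xs(4) by simp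
  ultimately show ?thesis using that by blast
qed

text \<open>
  The vertices are listed component by component, and within a component by their distance from
  a root. Neighbours differ by at most one in distance, so two steps towards the root
  compensate for a step away from it and for the order within a layer.
\<close>

lemma layered_enumeration:
  fixes V :: "nat set" and N :: "nat \<Rightarrow> nat \<Rightarrow> bool"
  assumes "finite V" and refl: "\<And>x. N x x" and sym: "\<And>x y. N x y \<Longrightarrow> N y x"
    and V: "\<And>x y. N x y \<Longrightarrow> x \<in> V \<Longrightarrow> y \<in> V"
  obtains e where "bij_betw e {..<card V} V"
    "\<And>i j k. i \<le> j \<Longrightarrow> j < card V \<Longrightarrow> k < card V \<Longrightarrow> N (e j) (e k) \<Longrightarrow>
      \<exists>u l. N (e i) u \<and> N u (e l) \<and> l \<le> k"
proof -
  \<comment> \<open>The least vertex of a component is its root, so comparing roots also orders the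
    components.\<close>
  define root where "root x = (LEAST y. N\<^sup>*\<^sup>* y x)" for x
  have root: "N\<^sup>*\<^sup>* (root x) x" for x
    unfolding root_def by (rule LeastI[of _ x]) simp
  have root_eq: "root x = root y" if "N x y" for x y
  proof -
    have "N\<^sup>*\<^sup>* z x \<longleftrightarrow> N\<^sup>*\<^sup>* z y" for z
      using rtranclp.rtrancl_into_rtrancl[of N z x y] rtranclp.rtrancl_into_rtrancl[of N z y x]
        that sym[OF that] by blast
    then show ?thesis by (simp add: root_def)
  qed
  define d where "d x = (LEAST m. (N ^^ m) (root x) x)" for x
  have d: "(N ^^ d x) (root x) x" for x
    unfolding d_def by (rule LeastI_ex) (use root[of x] in \<open>simp add: rtranclp_power\<close>)
  have d_le: "d x \<le> m" if "(N ^^ m) (root x) x" for x m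
    unfolding d_def using that by (rule Least_le)
  have d_adj: "d y \<le> d x + 1" if "N x y" for x y
  proof (rule d_le)
    show "(N ^^ (d x + 1)) (root y) y"
      using relpowp_Suc_I[OF d that] by (simp add: root_eq[OF that, symmetric])
  qed
  have d_0: "root x = x" if "d x = 0" for x
    using d[of x] that by simp
  have d_Suc: "\<exists>w. N x w \<and> root w = root x \<and> d w < d x" if nz: "d x \<noteq> 0" for x
  proof -
    obtain m where m: "d x = Suc m" using nz not0_implies_Suc by blast
    have "(N ^^ Suc m) (root x) x" using d[of x] unfolding m .
    then obtain w where w: "(N ^^ m) (root x) w" "N w x" by (rule relpowp_Suc_E)
    have "root w = root x" by (rule root_eq) fact
    moreover from this have "d w \<le> m" using w(1) by (intro d_le) simp
    ultimately show ?thesis using sym[OF w(2)] m by (intro exI[of _ w]) simp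
  qed
  \<comment> \<open>\<open>M\<close> exceeds every distance, so \<open>g\<close> below orders
    \<open>V\<close> lexicographically by component and then by distance from the root.\<close>
  define M where "M = Suc (Max (d ` V))"
  have M: "d x < M" if "x \<in> V" for x using that assms(1) by (simp add: M_def less_Suc_eq_le)
  define g where "g x = root x * M + d x" for x
  have g_root: "g x < g y" if "root x < root y" "x \<in> V" for x y
  proof -
    have "g x < (root x + 1) * M" using M[OF that(2)] by (simp add: g_def)
    also have "\<dots> \<le> root y * M" using that(1) by (intro mult_right_mono) auto
    finally show ?thesis by (simp add: g_def)
  qed
  obtain e where e: "bij_betw e {..<card V} V"
    "\<And>i j. i \<le> j \<Longrightarrow> j < card V \<Longrightarrow> g (e i) \<le> g (e j)"
    using sorted_enumeration[OF assms(1), of g] by blast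
  have e_V: "e i \<in> V" if "i < card V" for i using e(1) that by (auto simp: bij_betw_def)
  \<comment> \<open>Ties of \<open>g\<close> are listed in an unknown order, so \<open>v\<close>
    must have a strictly smaller value or be \<open>e k\<close> itself.\<close>
  have index: "\<exists>l\<le>k. v = e l" if "v \<in> V" "k < card V" "g v < g (e k) \<or> v = e k" for v k
  proof -
    obtain l where "l < card V" "v = e l" using e(1) \<open>v \<in> V\<close> by (auto simp: bij_betw_def)
    then show ?thesis using e(2)[of k l] that by (metis linorder_le_cases not_le order_refl)
  qed
  have "\<exists>u l. N (e i) u \<and> N u (e l) \<and> l \<le> k"
    if ij: "i \<le> j" "j < card V" and k: "k < card V" and N: "N (e j) (e k)" for i j k
  proof -
    define x where "x = e i"
    define y where "y = e j"
    define z where "z = e k"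
    have xyz: "x \<in> V" "y \<in> V" "z \<in> V" "g x \<le> g y" "N y z"
      using ij k e_V e(2) N by (auto simp: x_def y_def z_def)
    have yz: "root y = root z" "d y \<le> d z + 1"
      using root_eq[OF xyz(5)] d_adj[OF sym[OF xyz(5)]] by auto
    \<comment> \<open>If \<open>x\<close> lies in an earlier component, then \<open>x\<close> itself
      serves. Otherwise \<open>x\<close> is at most one layer beyond \<open>z\<close>, and two steps
      towards the root lead strictly below the layer of \<open>z\<close>. If the root is reached
      sooner, it is strictly below \<open>z\<close> or equal to \<open>z\<close>.\<close>
    have "\<exists>u v. N x u \<and> N u v \<and> (g v < g z \<or> v = z)"
    proof (cases "root x = root y")
      case False
      then have "root x < root z" using g_root[of y x] xyz yz by fastforce
      then show ?thesis using g_root[OF _ xyz(1)] refl by blast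
    next
      case True
      then have dx: "d x \<le> d z + 1" using xyz(4) yz by (simp add: g_def)
      have less: "g v < g z" if "root v = root x" "d v < d z" for v
        using that True yz by (simp add: g_def)
      show ?thesis
      proof (cases "d x = 0")
        case x0: True
        show ?thesis
        proof (cases "d z = 0")
          case True
          then show ?thesis using x0 d_0 \<open>root x = root y\<close> yz refl by metis
        qed (use less[of x] x0 refl in auto)
      next
        case False
        then obtain w where w: "N x w" "root w = root x" "d w < d x" using d_Suc by blast
        show ?thesis
        proof (cases "d w = 0")
          case w0: True
          show ?thesis
          proof (cases "d z = 0")
            case True
            then have "w = z" using w0 d_0 \<open>root x = root y\<close> yz w(2) by metis
            then show ?thesis using w refl by blast
          qed (use less[of w] w w0 refl in auto)
        next
          case False
          then obtain w' where "N w w'" "root w' = root w" "d w' < d w" using d_Suc by blast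
          then show ?thesis using less[of w'] w dx by auto
        qed
      qed
    qed
    then obtain u v where uv: "N x u" "N u v" "g v < g z \<or> v = z" by blast
    then have "v \<in> V" using V xyz(1) by blast
    then show ?thesis using uv index[of v k] k by (auto simp: x_def z_def)
  qed
  then show ?thesis using that e(1) by blast
qed

section \<open>A sentence bounding finitely generated models\<close>

text \<open>
  In the alternating group on \<open>{1..n}\<close> an element \<open>x\<close> stands for the point \<open>x 1\<close>. With suitable
  parameters, \<open>test_cycle\<close> holds of the 3-cycles through 1, so that \<open>stab\<close> is the stabilizer of 1;
  \<open>same x y\<close> says that \<open>x\<close> and \<open>y\<close> stand for the same point, and \<open>moves t z\<close> that \<open>t\<close> moves the
  point of \<open>z\<close>. A set of at least three points is the support of an even permutation, so
  quantifying over \<open>t\<close> amounts to quantifying over sets of points. When \<open>c\<close> maps each point of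
  an enumeration from \<open>x0\<close> to \<open>q\<close> to the next one, \<open>final\<close> holds of the \<open>t\<close> whose support is a
  nonempty final segment, and \<open>before\<close> is the order of the enumeration, up to ties among its
  last three points. These ties, and the fact that \<open>c\<close> has to be even and hence cannot be
  prescribed at the last two points, are the reason for the exceptional points \<open>q\<close> and \<open>r\<close>.
\<close>

definition test_cycle :: "('a, 'b) monoid_scheme \<Rightarrow> 'a \<Rightarrow> 'a list \<Rightarrow> 'a \<Rightarrow> bool" where
  "test_cycle G a bs x \<longleftrightarrow>
    (\<exists>k\<in>carrier G. x = k \<otimes>\<^bsub>G\<^esub> a \<otimes>\<^bsub>G\<^esub> inv\<^bsub>G\<^esub> k) \<and> (\<forall>b\<in>set bs. x \<otimes>\<^bsub>G\<^esub> b \<noteq> b \<otimes>\<^bsub>G\<^esub> x)"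

definition stab :: "('a, 'b) monoid_scheme \<Rightarrow> 'a \<Rightarrow> 'a list \<Rightarrow> 'a \<Rightarrow> bool" where
  "stab G a bs h \<longleftrightarrow>
    (\<forall>x\<in>carrier G. test_cycle G a bs x \<longleftrightarrow> test_cycle G a bs (h \<otimes>\<^bsub>G\<^esub> x \<otimes>\<^bsub>G\<^esub> inv\<^bsub>G\<^esub> h))"

definition same :: "('a, 'b) monoid_scheme \<Rightarrow> ('a \<Rightarrow> bool) \<Rightarrow> 'a \<Rightarrow> 'a \<Rightarrow> bool" where
  "same G H x y \<longleftrightarrow> H (inv\<^bsub>G\<^esub> x \<otimes>\<^bsub>G\<^esub> y)"

definition moves :: "('a, 'b) monoid_scheme \<Rightarrow> ('a \<Rightarrow> bool) \<Rightarrow> 'a \<Rightarrow> 'a \<Rightarrow> bool" where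
  "moves G H t z \<longleftrightarrow> \<not> H (inv\<^bsub>G\<^esub> z \<otimes>\<^bsub>G\<^esub> t \<otimes>\<^bsub>G\<^esub> z)"

definition final :: "('a, 'b) monoid_scheme \<Rightarrow> ('a \<Rightarrow> bool) \<Rightarrow> 'a \<Rightarrow> 'a \<Rightarrow> 'a \<Rightarrow> 'a \<Rightarrow> bool" where
  "final G H x0 c q t \<longleftrightarrow> moves G H t q \<and>
    (\<forall>z\<in>carrier G. moves G H t z \<longrightarrow> same G H (c \<otimes>\<^bsub>G\<^esub> z) x0 \<or> moves G H t (c \<otimes>\<^bsub>G\<^esub> z))"

definition before :: "('a, 'b) monoid_scheme \<Rightarrow> ('a \<Rightarrow> bool) \<Rightarrow> 'a \<Rightarrow> 'a \<Rightarrow> 'a \<Rightarrow> 'a \<Rightarrow> 'a \<Rightarrow> bool" where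
  "before G H x0 c q x y \<longleftrightarrow>
    (\<forall>t\<in>carrier G. final G H x0 c q t \<longrightarrow> moves G H t x \<longrightarrow> moves G H t y)"

text \<open>Adjacency is stated for elements instead of the left cosets that they represent: left
  multiplication descends to these cosets, and an edge at a point lifts to any element that
  represents it.\<close>

definition adj :: "('a, 'b) monoid_scheme \<Rightarrow> 'a set \<Rightarrow> 'a \<Rightarrow> 'a \<Rightarrow> bool" where
  "adj G S x y \<longleftrightarrow> x = y \<or> (\<exists>s\<in>S. y = s \<otimes>\<^bsub>G\<^esub> x \<or> x = s \<otimes>\<^bsub>G\<^esub> y)"

text \<open>The first clause makes the core of \<open>H\<close> trivial, so the action on cosets is
  faithful. The clauses record only what the finiteness argument uses; that \<open>R\<close> is an
  order is not among them.\<close>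

definition layered ::
    "('a, 'b) monoid_scheme \<Rightarrow> 'a set \<Rightarrow> ('a \<Rightarrow> bool) \<Rightarrow> ('a \<Rightarrow> 'a \<Rightarrow> bool) \<Rightarrow> 'a \<Rightarrow> 'a \<Rightarrow> 'a \<Rightarrow> bool" where
  "layered G S H R x0 q r \<longleftrightarrow>
    (\<forall>s\<in>carrier G. (\<forall>x\<in>carrier G. H (inv\<^bsub>G\<^esub> x \<otimes>\<^bsub>G\<^esub> s \<otimes>\<^bsub>G\<^esub> x)) \<longrightarrow> s = \<one>\<^bsub>G\<^esub>) \<and>
    (\<forall>x\<in>carrier G. R x x0 \<longrightarrow> same G H x x0) \<and>
    (\<forall>x\<in>carrier G. R x q) \<and>
    (\<forall>x\<in>carrier G. \<forall>y\<in>carrier G. \<forall>y'\<in>carrier G. R x y \<and> adj G S y y' \<longrightarrow>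
      same G H x q \<or> same G H x r \<or>
      (\<exists>u\<in>carrier G. \<exists>v\<in>carrier G. adj G S x u \<and> adj G S u v \<and> R v y'))"

text \<open>
  Variables 10 to 18 hold the parameters \<open>a, b1, b2, b3, b4, x0, c, q, r\<close>, and the variables from
  20 on hold the generators. Each level of formulas binds its own variables below 10, so that
  terms can be substituted without capture.
\<close>

abbreviation mul_form :: "gterm \<Rightarrow> gterm \<Rightarrow> gterm" (infixl "\<cdot>" 70) where "s \<cdot> t \<equiv> Mul s t"

definition test_cycle_form :: "gterm \<Rightarrow> gform" where
  "test_cycle_form s = Conj (Ex 0 (Eq s (Var 0 \<cdot> Var 10 \<cdot> Inv (Var 0))))
    (foldr (\<lambda>b. Conj (Neg (Eq (s \<cdot> Var b) (Var b \<cdot> s)))) [11, 12, 13, 14] (Eq Unit Unit))"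

definition stab_form :: "gterm \<Rightarrow> gform" where
  "stab_form s = All 1 (Conj
    (Impl (test_cycle_form (Var 1)) (test_cycle_form (s \<cdot> Var 1 \<cdot> Inv s)))
    (Impl (test_cycle_form (s \<cdot> Var 1 \<cdot> Inv s)) (test_cycle_form (Var 1))))"

definition same_form :: "gterm \<Rightarrow> gterm \<Rightarrow> gform" where
  "same_form s t = stab_form (Inv s \<cdot> t)"

definition moves_form :: "gterm \<Rightarrow> gterm \<Rightarrow> gform" where
  "moves_form t z = Neg (stab_form (Inv z \<cdot> t \<cdot> z))"

definition final_form :: "gterm \<Rightarrow> gform" where
  "final_form t = Conj (moves_form t (Var 17)) (All 2 (Impl (moves_form t (Var 2))
    (Disj (same_form (Var 16 \<cdot> Var 2) (Var 15)) (moves_form t (Var 16 \<cdot> Var 2)))))"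

definition before_form :: "gterm \<Rightarrow> gterm \<Rightarrow> gform" where
  "before_form s t = All 3 (Impl (final_form (Var 3))
    (Impl (moves_form (Var 3) s) (moves_form (Var 3) t)))"

definition adj_form :: "nat \<Rightarrow> gterm \<Rightarrow> gterm \<Rightarrow> gform" where
  "adj_form d s t =
    foldr (\<lambda>i. Disj (Disj (Eq t (Var i \<cdot> s)) (Eq s (Var i \<cdot> t)))) [20..<20 + d] (Eq s t)"

definition layered_form :: "nat \<Rightarrow> gform" where
  "layered_form d =
    Conj (All 4 (Impl (All 5 (stab_form (Inv (Var 5) \<cdot> Var 4 \<cdot> Var 5))) (Eq (Var 4) Unit)))
    (Conj (All 4 (Impl (before_form (Var 4) (Var 15)) (same_form (Var 4) (Var 15))))
    (Conj (All 4 (before_form (Var 4) (Var 17)))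
    (All 4 (All 5 (All 6 (Impl (Conj (before_form (Var 4) (Var 5)) (adj_form d (Var 5) (Var 6)))
      (Disj (same_form (Var 4) (Var 17)) (Disj (same_form (Var 4) (Var 18))
      (Ex 7 (Ex 8 (Conj (adj_form d (Var 4) (Var 7)) (Conj (adj_form d (Var 7) (Var 8))
        (before_form (Var 8) (Var 6))))))))))))))"

text \<open>\<open>Neg (Eq Unit Unit)\<close> is the empty disjunction. In the second disjunct the
  variables that list the group may take equal values, so it bounds the order by
  \<open>K\<close>.\<close>

definition layered_sentence :: "nat \<Rightarrow> nat \<Rightarrow> gform" where
  "layered_sentence d K =
    Disj (foldr All [20..<20 + d] (foldr Ex [10, 11, 12, 13, 14, 15, 16, 17, 18] (layered_form d)))
      (foldr Ex [20..<20 + K]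
        (All 0 (foldr (\<lambda>i. Disj (Eq (Var 0) (Var i))) [20..<20 + K] (Neg (Eq Unit Unit)))))"

section \<open>Semantics of the formulas\<close>

lemma term_val_fun_upd [simp]:
  "x \<notin> term_vars t \<Longrightarrow> term_val G (e(x := a)) t = term_val G e t"
  by (rule term_val_cong) auto

lemma sat_test_cycle_form:
  "0 \<notin> term_vars s \<Longrightarrow> sat G e (test_cycle_form s) \<longleftrightarrow>
    test_cycle G (e 10) (map e [11, 12, 13, 14]) (term_val G e s)"
  by (simp add: test_cycle_form_def test_cycle_def)

lemma sat_stab_form:
  "term_vars s \<inter> {0, 1} = {} \<Longrightarrow> sat G e (stab_form s) \<longleftrightarrow>
    stab G (e 10) (map e [11, 12, 13, 14]) (term_val G e s)"
  by (auto simp: stab_form_def stab_def sat_test_cycle_form)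

lemma sat_same_form:
  "term_vars s \<inter> {0, 1} = {} \<Longrightarrow> term_vars t \<inter> {0, 1} = {} \<Longrightarrow> sat G e (same_form s t) \<longleftrightarrow>
    same G (stab G (e 10) (map e [11, 12, 13, 14])) (term_val G e s) (term_val G e t)"
  by (simp add: same_form_def same_def sat_stab_form Int_Un_distrib2)

lemma sat_moves_form:
  "term_vars s \<inter> {0, 1} = {} \<Longrightarrow> term_vars t \<inter> {0, 1} = {} \<Longrightarrow> sat G e (moves_form s t) \<longleftrightarrow>
    moves G (stab G (e 10) (map e [11, 12, 13, 14])) (term_val G e s) (term_val G e t)"
  by (simp add: moves_form_def moves_def sat_stab_form Int_Un_distrib2)

lemma sat_final_form:
  "term_vars t \<inter> {0, 1, 2} = {} \<Longrightarrow> sat G e (final_form t) \<longleftrightarrow>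
    final G (stab G (e 10) (map e [11, 12, 13, 14])) (e 15) (e 16) (e 17) (term_val G e t)"
  by (simp add: final_form_def final_def sat_same_form sat_moves_form)

lemma sat_before_form:
  "term_vars s \<inter> {0, 1, 2, 3} = {} \<Longrightarrow> term_vars t \<inter> {0, 1, 2, 3} = {} \<Longrightarrow>
    sat G e (before_form s t) \<longleftrightarrow>
    before G (stab G (e 10) (map e [11, 12, 13, 14])) (e 15) (e 16) (e 17)
      (term_val G e s) (term_val G e t)"
  by (simp add: before_form_def before_def sat_final_form sat_moves_form)

lemma sat_foldr_Disj:
  "sat G e (foldr (\<lambda>i. Disj (f i)) xs p) \<longleftrightarrow> (\<exists>i\<in>set xs. sat G e (f i)) \<or> sat G e p"
  by (induction xs) auto

lemma sat_adj_form:
  "sat G e (adj_form d s t) \<longleftrightarrow> adj G (e ` {20..<20 + d}) (term_val G e s) (term_val G e t)"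
  by (auto simp: adj_form_def adj_def sat_foldr_Disj)

lemma sat_layered_form:
  "sat G e (layered_form d) \<longleftrightarrow>
    (let H = stab G (e 10) (map e [11, 12, 13, 14])
     in layered G (e ` {20..<20 + d}) H (before G H (e 15) (e 16) (e 17)) (e 15) (e 17) (e 18))"
proof -
  have [simp]: "e(x := a) ` {20..<20 + d} = e ` {20..<20 + d}" if "x < 20" for e :: "nat \<Rightarrow> 'a" and x a
    using that by (auto simp: image_def)
  show ?thesis
    by (simp add: layered_form_def layered_def Let_def sat_before_form sat_same_form sat_stab_form
        sat_adj_form)
qed

lemma sat_foldr_All:
  "sat G e (foldr All xs p) \<longleftrightarrow>
    (\<forall>f. f ` set xs \<subseteq> carrier G \<longrightarrow> (\<forall>x. x \<notin> set xs \<longrightarrow> f x = e x) \<longrightarrow> sat G f p)"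
proof (induction xs arbitrary: e)
  case Nil
  have "f = e" if "\<forall>x. f x = e x" for f using that by auto
  then show ?case by auto
next
  case (Cons y xs)
  show ?case
  proof (intro iffI allI impI)
    fix f
    assume e: "sat G e (foldr All (y # xs) p)" and
      f: "f ` set (y # xs) \<subseteq> carrier G" "\<forall>x. x \<notin> set (y # xs) \<longrightarrow> f x = e x"
    from e f(1) have "sat G (e(y := f y)) (foldr All xs p)" by simp
    then show "sat G f p" using f by (auto simp: Cons.IH)
  next
    assume *: "\<forall>f. f ` set (y # xs) \<subseteq> carrier G \<longrightarrow> (\<forall>x. x \<notin> set (y # xs) \<longrightarrow> f x = e x) \<longrightarrow> sat G f p"
    have "sat G f p" if "a \<in> carrier G" "f ` set xs \<subseteq> carrier G"
      "\<forall>x. x \<notin> set xs \<longrightarrow> f x = (e(y := a)) x" for a f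
      using *[rule_format, of f] that by (cases "y \<in> set xs") auto
    then show "sat G e (foldr All (y # xs) p)" by (simp add: Cons.IH)
  qed
qed

lemma sat_foldr_Ex:
  "sat G e (foldr Ex xs p) \<longleftrightarrow>
    (\<exists>f. f ` set xs \<subseteq> carrier G \<and> (\<forall>x. x \<notin> set xs \<longrightarrow> f x = e x) \<and> sat G f p)"
proof -
  have "sat G e (foldr Ex xs p) \<longleftrightarrow> \<not> sat G e (foldr All xs (Neg p))"
    by (induction xs arbitrary: e) auto
  then show ?thesis by (auto simp: sat_foldr_All)
qed

lemma is_sentence_layered_sentence: "is_sentence (layered_sentence d K)"
proof -
  have All: "free_vars (foldr All xs p) = free_vars p - set xs" for xs p
    by (induction xs) auto
  have Ex: "free_vars (foldr Ex xs p) = free_vars p - set xs" for xs p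
    by (induction xs) auto
  have Disj: "free_vars (foldr (\<lambda>i. Disj (f i)) xs p) = (\<Union>i\<in>set xs. free_vars (f i)) \<union> free_vars p"
    for f and xs :: "nat list" and p
    by (induction xs) auto
  have adj: "free_vars (adj_form d s t) \<subseteq> term_vars s \<union> term_vars t \<union> {20..<20 + d}" for s t
    unfolding adj_form_def Disj by auto
  have stab: "free_vars (stab_form s) \<subseteq> term_vars s \<union> {10..18}" for s
    by (auto simp: stab_form_def test_cycle_form_def)
  have moves: "free_vars (moves_form s t) \<subseteq> term_vars s \<union> term_vars t \<union> {10..18}" for s t
    using stab[of "Inv t \<cdot> s \<cdot> t"] by (auto simp: moves_form_def)
  have same: "free_vars (same_form s t) \<subseteq> term_vars s \<union> term_vars t \<union> {10..18}" for s t
    using stab[of "Inv s \<cdot> t"] by (auto simp: same_form_def)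
  have final: "free_vars (final_form t) \<subseteq> term_vars t \<union> {10..18}" for t
    using moves[of t "Var 17"] moves[of t "Var 2"] moves[of t "Var 16 \<cdot> Var 2"]
      same[of "Var 16 \<cdot> Var 2" "Var 15"]
    by (auto simp: final_form_def)
  have before: "free_vars (before_form s t) \<subseteq> term_vars s \<union> term_vars t \<union> {10..18}" for s t
    using moves[of "Var 3" s] moves[of "Var 3" t] final[of "Var 3"]
    by (auto simp: before_form_def)
  have "free_vars (layered_form d) \<subseteq> {10..18} \<union> {20..<20 + d}"
    unfolding layered_form_def free_vars.simps Un_subset_iff Diff_subset_conv
    by (intro conjI order_trans[OF stab] order_trans[OF same] order_trans[OF before] order_trans[OF adj])
      auto
  moreover have "{10..18} = {10, 11, 12, 13, 14, 15, 16, 17, 18 :: nat}" by auto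
  ultimately show ?thesis
    by (auto simp: is_sentence_def layered_sentence_def All Ex Disj simp del: foldr.simps)
qed

lemma models_layered_sentence:
  assumes "\<one>\<^bsub>G\<^esub> \<in> carrier G"
  shows "models G (layered_sentence d K) \<longleftrightarrow>
    (\<forall>g. g ` {..<d} \<subseteq> carrier G \<longrightarrow>
      (\<exists>a\<in>carrier G. \<exists>b1\<in>carrier G. \<exists>b2\<in>carrier G. \<exists>b3\<in>carrier G. \<exists>b4\<in>carrier G.
       \<exists>x0\<in>carrier G. \<exists>c\<in>carrier G. \<exists>q\<in>carrier G. \<exists>r\<in>carrier G.
        let H = stab G a [b1, b2, b3, b4]
        in layered G (g ` {..<d}) H (before G H x0 c q) x0 q r)) \<or>
    (\<exists>f. f ` {..<K} = carrier G)"
  (is "_ \<longleftrightarrow> (\<forall>g. _ \<longrightarrow> ?L (g ` {..<d})) \<or> _")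
proof -
  let ?e = "\<lambda>_ :: nat. \<one>\<^bsub>G\<^esub>"
  have image_shift: "f ` {20..<20 + m} = (\<lambda>i. f (20 + i)) ` {..<m}" for f :: "nat \<Rightarrow> 'a" and m
  proof -
    have "{20..<20 + m} = (+) 20 ` {..<m}" by (simp add: lessThan_atLeast0 image_add_atLeastLessThan add.commute)
    then show ?thesis by (simp only: image_image)
  qed
  have image_upd: "e(x := a) ` {20..<20 + m} = e ` {20..<20 + m}"
    if "x < 20" for e :: "nat \<Rightarrow> 'a" and x a m
    using that by (auto simp: image_def)
  have L: "sat G f (foldr Ex [10, 11, 12, 13, 14, 15, 16, 17, 18] (layered_form d)) \<longleftrightarrow>
      ?L (f ` {20..<20 + d})" for f
    by (simp add: sat_layered_form image_upd)
  have "sat G ?e (foldr All [20..<20 + d] (foldr Ex [10, 11, 12, 13, 14, 15, 16, 17, 18] (layered_form d)))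
      \<longleftrightarrow> (\<forall>g. g ` {..<d} \<subseteq> carrier G \<longrightarrow> ?L (g ` {..<d}))" (is "?l = ?r")
  proof
    assume l: ?l
    show ?r
    proof (intro allI impI)
      fix g assume "g ` {..<d} \<subseteq> carrier G"
      \<comment> \<open>Outside the block the assignment has to agree with the one in
        \<open>models\<close>, which is constantly the identity.\<close>
      then have "?L ((\<lambda>i. if i \<in> {20..<20 + d} then g (i - 20) else \<one>\<^bsub>G\<^esub>) ` {20..<20 + d})"
        using l[unfolded sat_foldr_All L, rule_format,
            of "\<lambda>i. if i \<in> {20..<20 + d} then g (i - 20) else \<one>\<^bsub>G\<^esub>"]
        by (force simp: image_subset_iff)
      then show "?L (g ` {..<d})" by (simp add: image_shift)
    qed
  next
    assume r: ?r
    show ?l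
      unfolding sat_foldr_All L
    proof (intro allI impI)
      fix f assume "f ` set [20..<20 + d] \<subseteq> carrier G"
      then show "?L (f ` {20..<20 + d})"
        using r[rule_format, of "\<lambda>i. f (20 + i)"] unfolding image_shift set_upt by blast
    qed
  qed
  moreover have "sat G ?e (foldr Ex [20..<20 + K]
        (All 0 (foldr (\<lambda>i. Disj (Eq (Var 0) (Var i))) [20..<20 + K] (Neg (Eq Unit Unit)))))
      \<longleftrightarrow> (\<exists>f. f ` {..<K} = carrier G)" (is "?l = ?r")
  proof
    assume ?l
    then obtain f where f: "f ` set [20..<20 + K] \<subseteq> carrier G"
      "\<And>a. a \<in> carrier G \<Longrightarrow> \<exists>i\<in>{20..<20 + K}. a = f i"
      unfolding sat_foldr_Ex by (auto simp: sat_foldr_Disj)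
    then have "f ` {20..<20 + K} = carrier G" unfolding set_upt by blast
    then show ?r unfolding image_shift by blast
  next
    assume ?r
    then obtain f where f: "f ` {..<K} = carrier G" by blast
    show ?l
      unfolding sat_foldr_Ex
    proof (intro exI conjI)
      let ?f = "\<lambda>i. if i \<in> {20..<20 + K} then f (i - 20) else \<one>\<^bsub>G\<^esub>"
      have f': "?f ` {20..<20 + K} = carrier G" unfolding image_shift by (simp add: f)
      then show "?f ` set [20..<20 + K] \<subseteq> carrier G" by simp
      show "\<forall>x. x \<notin> set [20..<20 + K] \<longrightarrow> ?f x = \<one>\<^bsub>G\<^esub>" by simp
      have "\<exists>i\<in>{20..<20 + K}. a = ?f i" if "a \<in> carrier G" for a
        using that unfolding f'[symmetric] by blast
      then show "sat G ?f (All 0 (foldr (\<lambda>i. Disj (Eq (Var 0) (Var i))) [20..<20 + K] (Neg (Eq Unit Unit))))"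
        by (force simp: sat_foldr_Disj)
    qed
  qed
  ultimately show ?thesis by (simp only: models_def layered_sentence_def sat.simps)
qed

section \<open>Finitely generated groups satisfying the sentence are finite\<close>

text \<open>These elements form the setwise stabilizer of the test cycles under conjugation.\<close>

lemma (in group) stab_subgroup: "subgroup {h \<in> carrier G. stab G a bs h} G"
proof (rule subgroupI)
  show "{h \<in> carrier G. stab G a bs h} \<noteq> {}"
    by (auto simp: stab_def intro!: exI[of _ "\<one>"])
next
  fix h assume h: "h \<in> {h \<in> carrier G. stab G a bs h}"
  have "test_cycle G a bs (inv h \<otimes> x \<otimes> inv (inv h)) \<longleftrightarrow> test_cycle G a bs x"
    if x: "x \<in> carrier G" for x
  proof -
    have "h \<otimes> (inv h \<otimes> x \<otimes> inv (inv h)) \<otimes> inv h = x"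
      using h x by (simp add: m_assoc[symmetric]) (simp add: m_assoc)
    then show ?thesis
      using h x by (metis (mono_tags, lifting) inv_closed m_closed mem_Collect_eq stab_def)
  qed
  then have "stab G a bs (inv h)" unfolding stab_def by blast
  then show "inv h \<in> {h \<in> carrier G. stab G a bs h}" using h by simp
next
  fix g h assume g: "g \<in> {h \<in> carrier G. stab G a bs h}" and h: "h \<in> {h \<in> carrier G. stab G a bs h}"
  have "test_cycle G a bs (g \<otimes> h \<otimes> x \<otimes> inv (g \<otimes> h)) \<longleftrightarrow> test_cycle G a bs x"
    if x: "x \<in> carrier G" for x
  proof -
    have "g \<otimes> h \<otimes> x \<otimes> inv (g \<otimes> h) = g \<otimes> (h \<otimes> x \<otimes> inv h) \<otimes> inv g"
      using g h x by (simp add: m_assoc inv_mult_group)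
    then show ?thesis
      using g h x by (metis (mono_tags, lifting) inv_closed m_closed mem_Collect_eq stab_def)
  qed
  then have "stab G a bs (g \<otimes> h)" unfolding stab_def by blast
  then show "g \<otimes> h \<in> {h \<in> carrier G. stab G a bs h}" using g h by simp
qed auto

text \<open>\<open>F\<close> meets every left coset of \<open>H\<close>, so there are finitely many
  cosets, and an element is determined by how it permutes them because the core of \<open>H\<close>
  is trivial.\<close>

lemma (in group) finite_core_free:
  assumes H: "subgroup {h \<in> carrier G. H h} G"
    and core: "\<And>s. s \<in> carrier G \<Longrightarrow> (\<And>x. x \<in> carrier G \<Longrightarrow> H (inv x \<otimes> s \<otimes> x)) \<Longrightarrow> s = \<one>"
    and F: "finite F" "F \<subseteq> carrier G" "\<And>x. x \<in> carrier G \<Longrightarrow> \<exists>f\<in>F. same G H x f"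
  shows "finite (carrier G)"
proof -
  \<comment> \<open>Several elements of \<open>F\<close> may represent the same coset, and one is
    picked. The argument rests on injectivity in \<open>g\<close>, not on this being an
    action.\<close>
  define act where "act g = (\<lambda>f\<in>F. SOME f'. f' \<in> F \<and> same G H (g \<otimes> f) f')" for g
  have act: "act g f \<in> F \<and> same G H (g \<otimes> f) (act g f)" if "g \<in> carrier G" "f \<in> F" for g f
  proof -
    have "\<exists>f'. f' \<in> F \<and> same G H (g \<otimes> f) f'" using F that by blast
    from someI_ex[OF this] show ?thesis using that by (simp add: act_def)
  qed
  have mult: "H (g \<otimes> h)" if "H g" "H h" "g \<in> carrier G" "h \<in> carrier G" for g h
    using subgroup.m_closed[OF H, of g h] that by simp
  have inv: "H (inv g)" if "H g" "g \<in> carrier G" for g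
    using subgroup.m_inv_closed[OF H, of g] that by simp
  have "inj_on act (carrier G)"
  proof (rule inj_onI)
    fix g g' assume g: "g \<in> carrier G" "g' \<in> carrier G" and eq: "act g = act g'"
    have "inv g \<otimes> g' = \<one>"
    proof (rule core)
      fix x assume x: "x \<in> carrier G"
      then obtain f where f: "f \<in> F" "same G H x f" using F by blast
      then have fc: "f \<in> carrier G" using F by blast
      define k where "k = act g f"
      have k: "k \<in> carrier G" "H (inv (g \<otimes> f) \<otimes> k)" "H (inv (g' \<otimes> f) \<otimes> k)"
        using act[OF g(1) f(1)] act[OF g(2) f(1)] eq F by (auto simp: k_def same_def)
      \<comment> \<open>The common representative \<open>k\<close> and the element \<open>f\<close>
        cancel from this product of elements of \<open>H\<close>, which leaves a conjugate of
        \<open>inv g \<otimes> g'\<close>.\<close>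
      have "H ((inv x \<otimes> f) \<otimes> ((inv (g \<otimes> f) \<otimes> k) \<otimes> inv (inv (g' \<otimes> f) \<otimes> k)) \<otimes> inv (inv x \<otimes> f))"
      proof -
        have "H (u \<otimes> (v \<otimes> inv w) \<otimes> inv u)"
          if "u \<in> carrier G" "v \<in> carrier G" "w \<in> carrier G" "H u" "H v" "H w" for u v w
          using that by (simp add: mult inv)
        from this[of "inv x \<otimes> f" "inv (g \<otimes> f) \<otimes> k" "inv (g' \<otimes> f) \<otimes> k"]
        show ?thesis using k fc g x f(2) by (simp add: same_def)
      qed
      moreover have "(inv x \<otimes> f) \<otimes> ((inv (g \<otimes> f) \<otimes> k) \<otimes> inv (inv (g' \<otimes> f) \<otimes> k)) \<otimes> inv (inv x \<otimes> f)
          = inv x \<otimes> (inv g \<otimes> g') \<otimes> x"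
      proof -
        have cancel: "u \<otimes> (inv u \<otimes> v) = v" "inv u \<otimes> (u \<otimes> v) = v"
          if "u \<in> carrier G" "v \<in> carrier G" for u v
          using that by (simp_all add: m_assoc[symmetric])
        show ?thesis using fc g x k(1) by (simp add: inv_mult_group m_assoc cancel)
      qed
      ultimately show "H (inv x \<otimes> (inv g \<otimes> g') \<otimes> x)" by simp
    qed (use g in simp)
    moreover have "g \<otimes> (inv g \<otimes> g') = g'" using g by (simp add: m_assoc[symmetric])
    ultimately show "g = g'" using g by simp
  qed
  moreover have "act ` carrier G \<subseteq> F \<rightarrow>\<^sub>E F" using act by (auto simp: act_def)
  then have "finite (act ` carrier G)" using F(1) by (meson finite_PiE finite_subset)
  ultimately show ?thesis by (rule finite_imageD[rotated])
qed

lemma (in group) layered_imp_finite: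
  assumes S: "finite S" "S \<subseteq> carrier G" "generate G S = carrier G"
    and H: "subgroup {h \<in> carrier G. H h} G"
    and carrier: "x0 \<in> carrier G" "q \<in> carrier G" "r \<in> carrier G"
    and layered: "layered G S H R x0 q r"
  shows "finite (carrier G)"
proof -
  have core: "s = \<one>" if "s \<in> carrier G" "\<And>x. x \<in> carrier G \<Longrightarrow> H (inv x \<otimes> s \<otimes> x)" for s
    using layered that unfolding layered_def by blast
  have bot: "same G H x x0" if "x \<in> carrier G" "R x x0" for x
    using layered that unfolding layered_def by blast
  have top: "R x q" if "x \<in> carrier G" for x
    using layered that unfolding layered_def by blast
  have step: "same G H x q \<or> same G H x r \<or>
      (\<exists>u\<in>carrier G. \<exists>v\<in>carrier G. adj G S x u \<and> adj G S u v \<and> R v y')"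
    if "x \<in> carrier G" "y \<in> carrier G" "y' \<in> carrier G" "R x y" "adj G S y y'" for x y y'
    using layered that unfolding layered_def by blast
  define B where "B = insert \<one> (S \<union> (\<lambda>s. inv s) ` S)"
  have B: "finite B" "B \<subseteq> carrier G" using S by (auto simp: B_def)
  have adj_B: "\<exists>s\<in>B. x = s \<otimes> y" if "adj G S x y" "x \<in> carrier G" "y \<in> carrier G" for x y
  proof -
    consider "x = y" | s where "s \<in> S" "y = s \<otimes> x" | s where "s \<in> S" "x = s \<otimes> y"
      using \<open>adj G S x y\<close> unfolding adj_def by blast
    then show ?thesis
    proof cases
      case 1
      then show ?thesis using that(2) by (intro bexI[of _ "\<one>"]) (simp_all add: B_def)
    next
      case 2
      then have "s \<in> carrier G" using S(2) by blast
      then have "inv s \<otimes> y = x" using 2(2) that(2) by (simp add: m_assoc[symmetric])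
      with 2(1) show ?thesis by (intro bexI[of _ "inv s"]) (simp_all add: B_def)
    next
      case 3
      then show ?thesis by (intro bexI[of _ s]) (simp_all add: B_def)
    qed
  qed
  \<comment> \<open>Finitely many cosets contain everything up to \<open>y\<close>: the external
    property that the induction over words carries.\<close>
  define covered where
    "covered y \<longleftrightarrow> (\<exists>F. finite F \<and> F \<subseteq> carrier G \<and> (\<forall>x\<in>carrier G. R x y \<longrightarrow> (\<exists>f\<in>F. same G H x f)))"
    for y
  have covered_adj: "covered y" if cov: "covered y'" and y: "y \<in> carrier G" "y' \<in> carrier G" "adj G S y y'"
    for y y'
  proof -
    obtain F where F: "finite F" "F \<subseteq> carrier G"
      "\<And>x. x \<in> carrier G \<Longrightarrow> R x y' \<Longrightarrow> \<exists>f\<in>F. same G H x f"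
      using cov unfolding covered_def by blast
    \<comment> \<open>\<open>q\<close> and \<open>r\<close> absorb the exceptional points. Any other
      \<open>x\<close> is \<open>s \<otimes> t \<otimes> v\<close> with \<open>R v y'\<close>, and
      replacing \<open>v\<close> by its representative in \<open>F\<close> keeps the coset of
      \<open>x\<close>.\<close>
    let ?F = "{q, r} \<union> (\<lambda>(s, t, f). s \<otimes> t \<otimes> f) ` (B \<times> B \<times> F)"
    have "\<exists>f\<in>?F. same G H x f" if x: "x \<in> carrier G" "R x y" for x
      using step[OF x(1) y(1,2) x(2) y(3)]
    proof (elim disjE bexE conjE)
      fix u v assume uv: "u \<in> carrier G" "v \<in> carrier G" "adj G S x u" "adj G S u v" "R v y'"
      obtain s t where st: "s \<in> B" "x = s \<otimes> u" "t \<in> B" "u = t \<otimes> v"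
        using adj_B uv x(1) by metis
      obtain f where f: "f \<in> F" "same G H v f" using F(3) uv by blast
      have "inv x \<otimes> (s \<otimes> t \<otimes> f) = inv v \<otimes> f"
      proof -
        have "s \<in> carrier G" "t \<in> carrier G" "f \<in> carrier G" using st B f F by auto
        then show ?thesis using st uv(2)
          by (simp add: inv_mult_group m_assoc) (simp add: m_assoc[symmetric])
      qed
      then have "same G H x (s \<otimes> t \<otimes> f)" using f(2) by (simp add: same_def)
      then show ?thesis using st f(1) by force
    qed auto
    moreover have "finite ?F" using B F by simp
    moreover have "?F \<subseteq> carrier G" using B F carrier by auto
    ultimately show ?thesis unfolding covered_def by blast
  qed
  have "covered x0" unfolding covered_def using bot carrier by (intro exI[of _ "{x0}"]) auto
  have covered_mult: "\<forall>y\<in>carrier G. covered y \<longrightarrow> covered (h \<otimes> y)" if "h \<in> generate G S" for h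
    using that
  proof (induction h rule: generate.induct)
    case one
    then show ?case by simp
  next
    case (incl h)
    have "covered (h \<otimes> y)" if "y \<in> carrier G" "covered y" for y
      using incl S(2) that by (intro covered_adj[OF that(2)]) (auto simp: adj_def)
    then show ?case by blast
  next
    case (inv h)
    have "h \<otimes> (inv h \<otimes> y) = y" if "y \<in> carrier G" for y
      using inv that S(2) by (auto simp: m_assoc[symmetric])
    then have "adj G S (inv h \<otimes> y) y" if "y \<in> carrier G" for y
      using inv that unfolding adj_def by (intro disjI2, intro bexI[of _ h], intro disjI1) simp_all
    moreover have "inv h \<in> carrier G" using inv S(2) by blast
    ultimately have "covered (inv h \<otimes> y)" if "y \<in> carrier G" "covered y" for y
      using that by (intro covered_adj[OF that(2)]) auto
    then show ?case by blast
  next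
    case (eng h k)
    then have "h \<otimes> k \<otimes> y = h \<otimes> (k \<otimes> y)" "k \<otimes> y \<in> carrier G" if "y \<in> carrier G" for y
      using S(3) that by (auto simp: m_assoc)
    then show ?case using eng.IH by metis
  qed
  \<comment> \<open>This element takes the first point to the last; since \<open>S\<close>
    generates, it is a word along which \<open>covered\<close> is preserved.\<close>
  have "q \<otimes> inv x0 \<in> generate G S" using carrier S(3) by simp
  then have "covered (q \<otimes> inv x0 \<otimes> x0)"
    using covered_mult \<open>covered x0\<close> carrier(1) by blast
  then have "covered q" using carrier by (simp add: m_assoc)
  then obtain F where F: "finite F" "F \<subseteq> carrier G"
    "\<forall>x\<in>carrier G. R x q \<longrightarrow> (\<exists>f\<in>F. same G H x f)"
    unfolding covered_def by (elim exE conjE)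
  show ?thesis
  proof (rule finite_core_free[OF H _ F(1,2)])
    show "\<exists>f\<in>F. same G H x f" if "x \<in> carrier G" for x using F(3) top that by simp
  qed (fact core)
qed

section \<open>Alternating groups satisfy the sentence\<close>

text \<open>A product of two disjoint transpositions is even, hence lies in the group, and is an
  involution, as \<open>three_cycle_commute_iff\<close> requires. The indices give each petal three
  points of its own besides 1; the fourth petal reaches up to 13.\<close>

definition petal :: "nat \<Rightarrow> nat \<Rightarrow> nat" where
  "petal k = transpose 1 (3 * k - 1) \<circ> transpose (3 * k) (3 * k + 1)"

abbreviation alt_stab :: "nat \<Rightarrow> (nat \<Rightarrow> nat) \<Rightarrow> bool" where
  "alt_stab n \<equiv> stab (alt_group n) (three_cycle 1 2 3) [petal 1, petal 2, petal 3, petal 4]"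

lemma petal_moves:
  assumes "k \<ge> 1"
  shows "petal k x \<noteq> x \<longleftrightarrow> x \<in> {1, 3 * k - 1, 3 * k, 3 * k + 1}"
  using assms by (auto simp: petal_def transpose_def)

lemma petal_involution:
  assumes "k \<ge> 1"
  shows "petal k (petal k x) = x"
  using assms by (auto simp: petal_def transpose_def)

lemma petal_alt_group:
  assumes "k \<ge> 1" "3 * k + 1 \<le> n"
  shows "petal k \<in> carrier (alt_group n)"
  using assms unfolding alt_group_carrier petal_def
  by (intro conjI permutes_compose permutes_swap_id evenperm_transpose_comp) auto

section \<open>Conjugation and the point stabilizer in alternating groups\<close>

lemma alt_group_conjugate:
  assumes "h \<in> carrier (alt_group n)" "i \<noteq> j" "i \<noteq> k" "j \<noteq> k"
  shows "h \<otimes>\<^bsub>alt_group n\<^esub> three_cycle i j k \<otimes>\<^bsub>alt_group n\<^esub> inv\<^bsub>alt_group n\<^esub> h =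
    three_cycle (h i) (h j) (h k)"
proof -
  have "bij h" using assms(1) by (auto simp: alt_group_carrier permutes_bij)
  then show ?thesis
    using conjugate_three_cycle[of h i j k] assms by (simp add: alt_group_mult alt_group_inv_equality)
qed

lemma alt_group_transitive:
  assumes "u \<in> {1..n}" "n \<ge> 3"
  obtains x where "x \<in> carrier (alt_group n)" "x 1 = u"
proof -
  obtain x where "x permutes {1..n}" "evenperm x" "\<And>y. y \<in> {1} \<Longrightarrow> x y = u"
    using assms permutes_evenperm_extend[of "{1..n}" "{1}" "\<lambda>_. u"] by auto
  then show ?thesis using that by (auto simp: alt_group_carrier)
qed

text \<open>Conjugation by \<open>h\<close> turns \<open>three_cycle 1 2 3\<close> into a prescribed
  3-cycle through 1. Three values are fixed, and the bound 5 leaves two points for the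
  parity.\<close>

lemma alt_group_three_cycles:
  assumes "n \<ge> 5" "u \<in> {1..n}" "v \<in> {1..n}" "u \<noteq> 1" "v \<noteq> 1" "u \<noteq> v"
  obtains h where "h \<in> carrier (alt_group n)" "h 1 = 1" "h 2 = u" "h 3 = v"
proof -
  let ?f = "\<lambda>x :: nat. if x = 1 then 1 else if x = 2 then u else v"
  have "inj_on ?f {1, 2, 3}" using assms by (auto simp: inj_on_def)
  then obtain h where "h permutes {1..n}" "evenperm h" "\<And>y. y \<in> {1, 2, 3} \<Longrightarrow> h y = ?f y"
    using assms permutes_evenperm_extend[of "{1..n}" "{1, 2, 3}" ?f] by auto
  then show ?thesis using that by (auto simp: alt_group_carrier)
qed

text \<open>
  The four petals pairwise meet only in the point 1, and a 3-cycle has only three points; so a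
  3-cycle that meets all petals passes through 1.
\<close>

lemma test_cycle_alt_group:
  assumes "n \<ge> 13"
  shows "test_cycle (alt_group n) (three_cycle 1 2 3) [petal 1, petal 2, petal 3, petal 4] x \<longleftrightarrow>
    (\<exists>u\<in>{1..n}. \<exists>v\<in>{1..n}. u \<noteq> 1 \<and> v \<noteq> 1 \<and> u \<noteq> v \<and> x = three_cycle 1 u v)"
    (is "?l \<longleftrightarrow> ?r")
proof
  assume ?l
  then obtain h where h: "h \<in> carrier (alt_group n)" and
    "x = h \<otimes>\<^bsub>alt_group n\<^esub> three_cycle 1 2 3 \<otimes>\<^bsub>alt_group n\<^esub> inv\<^bsub>alt_group n\<^esub> h" and
    comm: "\<And>k. k \<in> {1, 2, 3, 4} \<Longrightarrow> x \<circ> petal k \<noteq> petal k \<circ> x"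
    by (auto simp: test_cycle_def alt_group_mult)
  then have x: "x = three_cycle (h 1) (h 2) (h 3)" by (simp add: alt_group_conjugate)
  have "h permutes {1..n}" using h by (simp add: alt_group_carrier)
  then have in_V: "h 1 \<in> {1..n}" "h 2 \<in> {1..n}" "h 3 \<in> {1..n}" and
    distinct: "h 1 \<noteq> h 2" "h 1 \<noteq> h 3" "h 2 \<noteq> h 3"
    using assms permutes_in_image[of h "{1..n}"] permutes_inj[of h "{1..n}"]
    by (auto simp: inj_eq)
  have petals: "h 1 \<in> {1, 3 * k - 1, 3 * k, 3 * k + 1} \<or> h 2 \<in> {1, 3 * k - 1, 3 * k, 3 * k + 1} \<or>
      h 3 \<in> {1, 3 * k - 1, 3 * k, 3 * k + 1}" if k: "k \<in> {1, 2, 3, 4}" for k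
  proof -
    have "k \<ge> 1" using k by auto
    then show ?thesis
      using comm[OF k] three_cycle_commute_iff[OF distinct, of "petal k"]
        petal_involution[of k] petal_moves[of k]
      unfolding x by blast
  qed
  have "h 1 = 1 \<or> h 2 = 1 \<or> h 3 = 1"
    using petals[of 1] petals[of 2] petals[of 3] petals[of 4] by simp presburger
  then show ?r
  proof (elim disjE)
    assume "h 1 = 1"
    then show ?r using x in_V distinct by metis
  next
    assume "h 2 = 1"
    moreover have "x = three_cycle (h 2) (h 3) (h 1)"
      using distinct by (auto simp: x fun_eq_iff three_cycle_apply)
    ultimately show ?r using in_V distinct by metis
  next
    assume "h 3 = 1"
    moreover have "x = three_cycle (h 3) (h 1) (h 2)"
      using distinct by (auto simp: x fun_eq_iff three_cycle_apply)
    ultimately show ?r using in_V distinct by metis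
  qed
next
  assume ?r
  then obtain u v where uv: "u \<in> {1..n}" "v \<in> {1..n}" "u \<noteq> 1" "v \<noteq> 1" "u \<noteq> v"
    and x: "x = three_cycle 1 u v"
    by blast
  obtain h where h: "h \<in> carrier (alt_group n)" "h 1 = 1" "h 2 = u" "h 3 = v"
    using alt_group_three_cycles[of n u v] uv assms by auto
  have "x = h \<otimes>\<^bsub>alt_group n\<^esub> three_cycle 1 2 3 \<otimes>\<^bsub>alt_group n\<^esub> inv\<^bsub>alt_group n\<^esub> h"
    using alt_group_conjugate[OF h(1), of 1 2 3] h x by simp
  moreover have "x \<circ> petal k \<noteq> petal k \<circ> x" if "k \<ge> 1" for k
    using three_cycle_commute_iff[of 1 u v "petal k"] uv petal_involution[OF that]
      petal_moves[OF that, of 1] by (auto simp: x)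
  ultimately show ?l using h(1) by (auto simp: test_cycle_def alt_group_mult)
qed

text \<open>Conjugation by \<open>h\<close> turns the 3-cycles through 1 into those through
  \<open>h 1\<close>, and 1 is the only point common to all 3-cycles through 1.\<close>

lemma alt_stab_iff:
  assumes n: "n \<ge> 13" and h: "h \<in> carrier (alt_group n)"
  shows "alt_stab n h \<longleftrightarrow> h 1 = 1"
proof
  let ?A = "alt_group n"
  let ?test = "test_cycle ?A (three_cycle 1 2 3) [petal 1, petal 2, petal 3, petal 4]"
  interpret A: group ?A by (rule alt_group_is_group)
  have image: "g u \<in> {1..n} \<longleftrightarrow> u \<in> {1..n}" and inj: "g u = g v \<longleftrightarrow> u = v"
    if "g \<in> carrier ?A" for g u v
  proof -
    have g: "g permutes {1..n}" using that by (simp add: alt_group_carrier)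
    show "g u \<in> {1..n} \<longleftrightarrow> u \<in> {1..n}" by (rule permutes_in_image[OF g])
    show "g u = g v \<longleftrightarrow> u = v" by (rule inj_eq[OF permutes_inj[OF g]])
  qed
  {
    assume "h 1 = 1"
    have *: "?test (g \<otimes>\<^bsub>?A\<^esub> x \<otimes>\<^bsub>?A\<^esub> inv\<^bsub>?A\<^esub> g)"
      if g: "g \<in> carrier ?A" "g 1 = 1" and x: "?test x" for g x
    proof -
      obtain u v where uv: "u \<in> {1..n}" "v \<in> {1..n}" "u \<noteq> 1" "v \<noteq> 1" "u \<noteq> v" "x = three_cycle 1 u v"
        using x unfolding test_cycle_alt_group[OF n] by blast
      then have "g \<otimes>\<^bsub>?A\<^esub> x \<otimes>\<^bsub>?A\<^esub> inv\<^bsub>?A\<^esub> g = three_cycle 1 (g u) (g v)"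
        using alt_group_conjugate[OF g(1), of 1 u v] g(2) by simp
      moreover have "g u \<noteq> 1" "g v \<noteq> 1" "g u \<noteq> g v"
        using uv inj[OF g(1)] g(2) by metis+
      ultimately show ?thesis
        using uv image[OF g(1)] unfolding test_cycle_alt_group[OF n] by blast
    qed
    have inv: "inv\<^bsub>?A\<^esub> h \<in> carrier ?A" "(inv\<^bsub>?A\<^esub> h) 1 = 1"
    proof -
      have "h permutes {1..n}" using h by (simp add: alt_group_carrier)
      then show "(inv\<^bsub>?A\<^esub> h) 1 = 1"
        using \<open>h 1 = 1\<close> by (simp add: alt_group_inv_equality[OF h] permutes_inv_eq)
    qed (use h in simp)
    have "?test x" if x: "x \<in> carrier ?A" "?test (h \<otimes>\<^bsub>?A\<^esub> x \<otimes>\<^bsub>?A\<^esub> inv\<^bsub>?A\<^esub> h)" for x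
    proof -
      have "inv\<^bsub>?A\<^esub> h \<otimes>\<^bsub>?A\<^esub> (h \<otimes>\<^bsub>?A\<^esub> x \<otimes>\<^bsub>?A\<^esub> inv\<^bsub>?A\<^esub> h) \<otimes>\<^bsub>?A\<^esub> inv\<^bsub>?A\<^esub> (inv\<^bsub>?A\<^esub> h) = x"
        using h x(1) by (simp add: A.m_assoc[symmetric]) (simp add: A.m_assoc)
      then show ?thesis using *[OF inv x(2)] by simp
    qed
    then show "alt_stab n h" using *[OF h \<open>h 1 = 1\<close>] unfolding stab_def by blast
  next
    assume stab: "alt_stab n h"
    show "h 1 = 1"
    proof (rule ccontr)
      assume "h 1 \<noteq> 1"
      define p where "p = inv' h 1"
      have "h permutes {1..n}" using h by (simp add: alt_group_carrier)
      then have p: "h p = 1" by (simp add: p_def permutes_inverses)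
      \<comment> \<open>Of three candidates at least two differ from \<open>p\<close>, the point
        sent to 1. With these, \<open>h\<close> conjugates a test cycle to a 3-cycle that avoids
        1.\<close>
      have "\<exists>u\<in>{2, 3, 4}. \<exists>v\<in>{2, 3, 4}. u \<noteq> p \<and> v \<noteq> p \<and> u \<noteq> v" by auto
      then obtain u v where uv: "u \<in> {2, 3, 4}" "v \<in> {2, 3, 4}" "u \<noteq> p" "v \<noteq> p" "u \<noteq> v" by blast
      have "?test (three_cycle 1 u v)"
        unfolding test_cycle_alt_group[OF n] using uv n by (intro bexI[of _ u] bexI[of _ v]) auto
      moreover have "three_cycle 1 u v \<in> carrier ?A"
        using uv n unfolding alt_group_carrier
        by (intro conjI permutes_three_cycle evenperm_three_cycle) auto
      ultimately have "?test (three_cycle (h 1) (h u) (h v))"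
        using stab alt_group_conjugate[OF h, of 1 u v] uv unfolding stab_def by auto
      then obtain u' v' where "u' \<noteq> 1" "v' \<noteq> 1" "u' \<noteq> v'"
        "three_cycle (h 1) (h u) (h v) = three_cycle 1 u' v'"
        unfolding test_cycle_alt_group[OF n] by blast
      then have "three_cycle (h 1) (h u) (h v) 1 \<noteq> 1" by (simp add: three_cycle_apply)
      moreover have "h u \<noteq> 1" "h v \<noteq> 1" "h u \<noteq> h v" "h 1 \<noteq> h u" "h 1 \<noteq> h v"
        using inj[OF h] p uv by (metis, metis, simp, auto)
      ultimately show False using \<open>h 1 \<noteq> 1\<close> by (simp add: three_cycle_apply)
    qed
  }
qed

lemma layered_alt_group:
  assumes n: "n \<ge> 13" and S: "S \<subseteq> carrier (alt_group n)"
  shows "\<exists>x0\<in>carrier (alt_group n). \<exists>c\<in>carrier (alt_group n). \<exists>q\<in>carrier (alt_group n).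
    \<exists>r\<in>carrier (alt_group n).
      layered (alt_group n) S (alt_stab n) (before (alt_group n) (alt_stab n) x0 c q) x0 q r"
proof -
  let ?A = "alt_group n" and ?V = "{1..n}"
  interpret A: group ?A by (rule alt_group_is_group)
  define H where "H = alt_stab n"
  have H_iff: "H h \<longleftrightarrow> h 1 = 1" if "h \<in> carrier ?A" for h
    unfolding H_def by (rule alt_stab_iff[OF n that])
  have perm: "x permutes ?V" if "x \<in> carrier ?A" for x using that by (simp add: alt_group_carrier)
  have image: "x u \<in> ?V" if "x \<in> carrier ?A" "u \<in> ?V" for x u
    using permutes_in_image[OF perm[OF that(1)]] that(2) by blast
  have inv_apply: "(inv\<^bsub>?A\<^esub> x) u = v \<longleftrightarrow> u = x v" if "x \<in> carrier ?A" for x u v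
    unfolding alt_group_inv_equality[OF that] permutes_inv_eq[OF perm[OF that]] by (rule eq_commute)
  have one: "1 \<in> ?V" using n by simp
  have same: "same ?A H x y \<longleftrightarrow> x 1 = y 1" if "x \<in> carrier ?A" "y \<in> carrier ?A" for x y
  proof -
    have "inv\<^bsub>?A\<^esub> x \<otimes>\<^bsub>?A\<^esub> y \<in> carrier ?A" using that by simp
    from H_iff[OF this] show ?thesis
      using that by (auto simp: same_def alt_group_mult inv_apply)
  qed
  have moves: "moves ?A H t z \<longleftrightarrow> t (z 1) \<noteq> z 1"
    if "t \<in> carrier ?A" "z \<in> carrier ?A" for t z
  proof -
    have "inv\<^bsub>?A\<^esub> z \<otimes>\<^bsub>?A\<^esub> t \<otimes>\<^bsub>?A\<^esub> z \<in> carrier ?A" using that by simp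
    from H_iff[OF this] show ?thesis
      using that by (simp add: moves_def alt_group_mult inv_apply)
  qed
  have trans: "\<exists>z\<in>carrier ?A. z 1 = w" if w: "w \<in> ?V" for w
  proof -
    obtain z where "z \<in> carrier ?A" "z 1 = w"
      by (rule alt_group_transitive[OF w]) (use n in simp)
    then show ?thesis by blast
  qed

  \<comment> \<open>The Schreier graph on the points, with loops: the image of \<open>adj\<close>
    when each \<open>x\<close> is replaced by \<open>x 1\<close>.\<close>
  define N where "N u w \<longleftrightarrow> u = w \<or> (\<exists>s\<in>S. w = s u \<or> u = s w)" for u w :: nat
  have N_V: "w \<in> ?V" if "N u w" "u \<in> ?V" for u w
  proof -
    have "s v \<in> ?V \<longleftrightarrow> v \<in> ?V" if "s \<in> S" for s v
      using that S by (intro permutes_in_image perm) blast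
    then show ?thesis using that unfolding N_def by metis
  qed
  have N_lift: "\<exists>y\<in>carrier ?A. adj ?A S x y \<and> y 1 = w" if x: "x \<in> carrier ?A" and "N (x 1) w" for x w
  proof -
    consider "x 1 = w" | s where "s \<in> S" "w = s (x 1)" | s where "s \<in> S" "x 1 = s w"
      using \<open>N (x 1) w\<close> unfolding N_def by blast
    then show ?thesis
    proof cases
      case 1
      then show ?thesis using x by (auto simp: adj_def)
    next
      case 2
      then have s: "s \<in> carrier ?A" using S by blast
      have "adj ?A S x (s \<otimes>\<^bsub>?A\<^esub> x)" using 2(1) unfolding adj_def by blast
      moreover have "(s \<otimes>\<^bsub>?A\<^esub> x) 1 = w" using 2(2) by (simp add: alt_group_mult)
      ultimately show ?thesis using A.m_closed[OF s x] by blast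
    next
      case 3
      then have s: "s \<in> carrier ?A" using S by blast
      have "x = s \<otimes>\<^bsub>?A\<^esub> (inv\<^bsub>?A\<^esub> s \<otimes>\<^bsub>?A\<^esub> x)"
        using s x by (simp add: A.m_assoc[symmetric])
      then have "adj ?A S x (inv\<^bsub>?A\<^esub> s \<otimes>\<^bsub>?A\<^esub> x)"
        using 3(1) unfolding adj_def by blast
      moreover have "(inv\<^bsub>?A\<^esub> s \<otimes>\<^bsub>?A\<^esub> x) 1 = w"
        using inv_apply[OF s] 3(2) by (simp add: alt_group_mult)
      ultimately show ?thesis using s x by (intro bexI[of _ "inv\<^bsub>?A\<^esub> s \<otimes>\<^bsub>?A\<^esub> x"]) auto
    qed
  qed

  obtain e where e: "bij_betw e {..<n} ?V" and e_N: "\<And>i j k. i \<le> j \<Longrightarrow> j < n \<Longrightarrow> k < n \<Longrightarrow>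
      N (e j) (e k) \<Longrightarrow> \<exists>u l. N (e i) u \<and> N u (e l) \<and> l \<le> k"
  proof (rule layered_enumeration[of ?V N])
    fix e assume "bij_betw e {..<card ?V} ?V" and "\<And>i j k. i \<le> j \<Longrightarrow> j < card ?V \<Longrightarrow>
      k < card ?V \<Longrightarrow> N (e j) (e k) \<Longrightarrow> \<exists>u l. N (e i) u \<and> N u (e l) \<and> l \<le> k"
    then show thesis by (intro that[of e]) simp_all
  next
    show "w \<in> ?V" if "N u w" "u \<in> ?V" for u w using that by (rule N_V)
  qed (auto simp: N_def)
  have e_V: "e i \<in> ?V" if "i < n" for i using e that by (auto simp: bij_betw_def)
  have e_inj: "e i = e j \<longleftrightarrow> i = j" if "i < n" "j < n" for i j
    using e that by (auto simp: bij_betw_def inj_on_def)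
  have e_surj: "\<exists>i<n. w = e i" if "w \<in> ?V" for w
    using e that by (auto simp: bij_betw_def)

  obtain c where c: "c \<in> carrier ?A" and c_Suc: "\<And>i. i < n - 2 \<Longrightarrow> c (e i) = e (Suc i)"
  proof -
    let ?f = "\<lambda>w. e (Suc (the_inv_into {..<n} e w))"
    have f: "?f (e i) = e (Suc i)" if "i < n" for i
      using e that by (simp add: bij_betw_def the_inv_into_f_f)
    have "inj_on ?f (e ` {..<n - 2})" using f e_inj by (auto simp: inj_on_def)
    moreover have "?f ` e ` {..<n - 2} \<subseteq> ?V"
    proof (clarify)
      fix i assume "i < n - 2"
      then show "?f (e i) \<in> ?V" using f[of i] e_V[of "Suc i"] by simp
    qed
    moreover have "e ` {..<n - 2} \<subseteq> ?V" using e_V by auto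
    moreover have "card (e ` {..<n - 2}) = n - 2"
      using e_inj by (subst card_image) (auto simp: inj_on_def)
    moreover from this have "card (e ` {..<n - 2}) + 2 \<le> card ?V" using n by simp
    ultimately obtain c where "c permutes ?V" "evenperm c" "\<And>w. w \<in> e ` {..<n - 2} \<Longrightarrow> c w = ?f w"
      using permutes_evenperm_extend[OF finite_atLeastAtMost, of "e ` {..<n - 2}" 1 n ?f] by blast
    then show ?thesis using that[of c] f by (simp add: alt_group_carrier)
  qed
  \<comment> \<open>The points \<open>e 1\<close> to \<open>e (n - 2)\<close> are already taken as
    images. Both remaining values are harmless: \<open>final\<close> excuses a return to
    \<open>e 0\<close>, and its first clause puts \<open>e (n - 1)\<close> into the support.\<close>
  have c_last: "c (e i) = e 0 \<or> c (e i) = e (n - 1)" if i: "n - 2 \<le> i" "i < n" for i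
  proof -
    obtain l where l: "l < n" "c (e i) = e l" using e_surj image[OF c e_V[OF i(2)]] by blast
    have "l = 0 \<or> l = n - 1"
    proof (rule ccontr)
      assume *: "\<not> (l = 0 \<or> l = n - 1)"
      then have "l - 1 < n - 2" "Suc (l - 1) = l" using l by auto
      then have "c (e (l - 1)) = c (e i)" using c_Suc[of "l - 1"] l(2) by simp
      then have "e (l - 1) = e i" using permutes_inj[OF perm[OF c]] by (simp add: inj_eq)
      then show False using e_inj[of "l - 1" i] i l \<open>l - 1 < n - 2\<close> by simp
    qed
    then show ?thesis using l by auto
  qed

  obtain x0 where x0: "x0 \<in> carrier ?A" "x0 1 = e 0" using trans[OF e_V[of 0]] n by auto
  obtain q where q: "q \<in> carrier ?A" "q 1 = e (n - 1)" using trans[OF e_V[of "n - 1"]] n by auto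
  obtain r where r: "r \<in> carrier ?A" "r 1 = e (n - 2)" using trans[OF e_V[of "n - 2"]] n by auto
  let ?R = "before ?A H x0 c q"
  have final: "final ?A H x0 c q t \<longleftrightarrow>
      t (e (n - 1)) \<noteq> e (n - 1) \<and> (\<forall>w\<in>?V. t w \<noteq> w \<longrightarrow> c w = e 0 \<or> t (c w) \<noteq> c w)"
    if t: "t \<in> carrier ?A" for t
  proof -
    have "same ?A H (c \<otimes>\<^bsub>?A\<^esub> z) x0 \<longleftrightarrow> c (z 1) = e 0"
      "moves ?A H t (c \<otimes>\<^bsub>?A\<^esub> z) \<longleftrightarrow> t (c (z 1)) \<noteq> c (z 1)" if z: "z \<in> carrier ?A" for z
    proof -
      have cz: "c \<otimes>\<^bsub>?A\<^esub> z \<in> carrier ?A" "(c \<otimes>\<^bsub>?A\<^esub> z) 1 = c (z 1)"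
        using A.m_closed[OF c z] by (simp_all add: alt_group_mult)
      show "same ?A H (c \<otimes>\<^bsub>?A\<^esub> z) x0 \<longleftrightarrow> c (z 1) = e 0"
        using same[OF cz(1) x0(1)] cz(2) x0(2) by simp
      show "moves ?A H t (c \<otimes>\<^bsub>?A\<^esub> z) \<longleftrightarrow> t (c (z 1)) \<noteq> c (z 1)"
        using moves[OF t cz(1)] cz(2) by simp
    qed
    then have "final ?A H x0 c q t \<longleftrightarrow> t (e (n - 1)) \<noteq> e (n - 1) \<and>
        (\<forall>z\<in>carrier ?A. t (z 1) \<noteq> z 1 \<longrightarrow> c (z 1) = e 0 \<or> t (c (z 1)) \<noteq> c (z 1))"
      unfolding final_def using t q by (auto simp: moves)
    also have "(\<forall>z\<in>carrier ?A. t (z 1) \<noteq> z 1 \<longrightarrow> c (z 1) = e 0 \<or> t (c (z 1)) \<noteq> c (z 1)) \<longleftrightarrow>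
        (\<forall>w\<in>?V. t w \<noteq> w \<longrightarrow> c w = e 0 \<or> t (c w) \<noteq> c w)"
      using trans image[OF _ one] by metis
    finally show ?thesis .
  qed

  have before_le: "?R x y"
    if x: "x \<in> carrier ?A" "x 1 = e i" and y: "y \<in> carrier ?A" "y 1 = e j" and ij: "i \<le> j" "j < n"
    for x y i j
  proof -
    \<comment> \<open>The support of \<open>t\<close> is closed under successors where
      \<open>c\<close> is prescribed; the step to \<open>e (n - 1)\<close> is covered by the first
      clause of \<open>final\<close>.\<close>
    have "t (e j) \<noteq> e j" if t: "t \<in> carrier ?A" "final ?A H x0 c q t" "t (e i) \<noteq> e i" for t
      using ij
    proof (induction j rule: dec_induct)
      case (step k)
      then have k: "t (e k) \<noteq> e k" "e k \<in> ?V" using e_V[of k] by simp_all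
      show ?case
      proof (cases "k < n - 2")
        case True
        then have "c (e k) = e (Suc k)" by (rule c_Suc)
        moreover have "e (Suc k) \<noteq> e 0" using e_inj[of "Suc k" 0] step.prems by simp
        ultimately show ?thesis using final[OF t(1)] t(2) k by metis
      next
        case False
        then have "Suc k = n - 1" using step.prems by simp
        then show ?thesis using final[OF t(1)] t(2) by simp
      qed
    qed (use t(3) in simp)
    then show ?thesis using x y by (simp add: before_def moves)
  qed
  have before_imp: "i \<le> j \<or> n - 3 \<le> j"
    if x: "x \<in> carrier ?A" "x 1 = e i" and y: "y \<in> carrier ?A" "y 1 = e j"
      and ij: "i < n" "j < n" and R: "?R x y" for x y i j
  proof (rule ccontr)
    assume "\<not> (i \<le> j \<or> n - 3 \<le> j)"
    then have j: "j < i" "j < n - 3" by auto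
    \<comment> \<open>The points after \<open>e j\<close> number at least three, so they are the
      support of an even permutation. It is final and separates \<open>x\<close> from
      \<open>y\<close>.\<close>
    define T where "T = e ` {Suc j..<n}"
    have T_V: "T \<subseteq> ?V" using e_V by (auto simp: T_def)
    have T: "e l \<in> T \<longleftrightarrow> j < l" if "l < n" for l
      using that e_inj[OF that] by (auto simp: T_def image_iff Suc_le_eq)
    have "card T = n - Suc j"
      unfolding T_def using e_inj by (subst card_image) (auto simp: inj_on_def)
    then have "3 \<le> card T" using j(2) by simp
    moreover have "finite T" by (simp add: T_def)
    ultimately obtain t where t: "t permutes T" "evenperm t" "\<And>w. w \<in> T \<Longrightarrow> t w \<noteq> w"
      using evenperm_with_support[of T] by blast
    have t_iff: "t w \<noteq> w \<longleftrightarrow> w \<in> T" for w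
      using t(3)[of w] permutes_not_in[OF t(1), of w] by blast
    have tc: "t \<in> carrier ?A"
      using permutes_subset[OF t(1) T_V] t(2) by (simp add: alt_group_carrier)
    have "c w = e 0 \<or> c w \<in> T" if w: "w \<in> T" for w
    proof -
      obtain l where l: "l < n" "w = e l" using w by (auto simp: T_def)
      then have "j < l" using T w by blast
      show ?thesis
      proof (cases "l < n - 2")
        case True
        then show ?thesis using c_Suc l T[of "Suc l"] \<open>j < l\<close> by simp
      next
        case False
        then show ?thesis using c_last[of l] l T[of "n - 1"] j by auto
      qed
    qed
    then have "final ?A H x0 c q t"
      using T[of "n - 1"] j ij unfolding final[OF tc] t_iff by auto
    moreover have "moves ?A H t x" using moves[OF tc x(1)] x(2) t_iff T[of i] ij j by simp
    moreover have "\<not> moves ?A H t y" using moves[OF tc y(1)] y(2) t_iff T[of j] ij by simp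
    ultimately show False using R tc unfolding before_def by blast
  qed

  have "layered ?A S H ?R x0 q r"
    unfolding layered_def
  proof (intro conjI ballI impI)
    fix s assume s: "s \<in> carrier ?A"
      and *: "\<forall>x\<in>carrier ?A. H (inv\<^bsub>?A\<^esub> x \<otimes>\<^bsub>?A\<^esub> s \<otimes>\<^bsub>?A\<^esub> x)"
    have "s w = w" for w
    proof (cases "w \<in> ?V")
      case True
      then obtain x where x: "x \<in> carrier ?A" "x 1 = w" using trans by blast
      then have "\<not> moves ?A H s x" using * by (simp add: moves_def)
      then show ?thesis using moves[OF s x(1)] x(2) by simp
    next
      case False
      then show ?thesis using perm[OF s] by (rule permutes_not_in[rotated])
    qed
    then show "s = \<one>\<^bsub>?A\<^esub>" by (simp add: alt_group_one fun_eq_iff)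
  next
    fix x assume x: "x \<in> carrier ?A" "?R x x0"
    obtain i where i: "i < n" "x 1 = e i" using e_surj image[OF x(1) one] by blast
    have "i = 0" using before_imp[OF x(1) i(2) x0 i(1) _ x(2)] n by simp
    then show "same ?A H x x0" using same[OF x(1) x0(1)] i x0 by simp
  next
    fix x assume x: "x \<in> carrier ?A"
    obtain i where i: "i < n" "x 1 = e i" using e_surj image[OF x one] by blast
    then show "?R x q" using before_le[OF x i(2) q] n by simp
  next
    fix x y y' assume x: "x \<in> carrier ?A" and y: "y \<in> carrier ?A" and y': "y' \<in> carrier ?A"
      and R: "?R x y \<and> adj ?A S y y'"
    obtain i where i: "i < n" "x 1 = e i" using e_surj image[OF x one] by blast
    obtain j where j: "j < n" "y 1 = e j" using e_surj image[OF y one] by blast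
    obtain k where k: "k < n" "y' 1 = e k" using e_surj image[OF y' one] by blast
    have "N (y 1) (y' 1)"
      using R unfolding adj_def N_def by (auto simp: alt_group_mult)
    then have N: "N (e j) (e k)" using j k by simp
    show "same ?A H x q \<or> same ?A H x r \<or>
      (\<exists>u\<in>carrier ?A. \<exists>v\<in>carrier ?A. adj ?A S x u \<and> adj ?A S u v \<and> ?R v y')"
    proof (cases "i \<le> j")
      case False
      \<comment> \<open>The order is misread only if \<open>j < i\<close> and
        \<open>n - 3 \<le> j\<close>; then \<open>i\<close> is one of the last two indices, whose
        points \<open>q\<close> and \<open>r\<close> represent.\<close>
      then have "i = n - 1 \<or> i = n - 2"
        using before_imp[OF x i(2) y j(2) i(1) j(1)] R i(1) by auto
      then show ?thesis using same[OF x q(1)] same[OF x r(1)] i q r by auto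
    next
      case True
      then obtain w l where wl: "N (x 1) w" "N w (e l)" "l \<le> k"
        using e_N[OF True j(1) k(1) N] i(2) by auto
      obtain u where u: "u \<in> carrier ?A" "adj ?A S x u" "u 1 = w" using N_lift[OF x wl(1)] by blast
      then obtain v where v: "v \<in> carrier ?A" "adj ?A S u v" "v 1 = e l"
        using N_lift[of u "e l"] wl(2) by blast
      have "?R v y'" by (rule before_le[OF v(1,3) y' k(2) wl(3) k(1)])
      then show ?thesis using u v by blast
    qed
  qed
  then show ?thesis
    unfolding H_def by (rule bexI[OF bexI[OF bexI[OF bexI[OF _ r(1)] q(1)] c] x0(1)])
qed

text \<open>For \<open>n < 13\<close> the four petals do not fit, and the disjunct on the order is
  used.\<close>

lemma alt_group_models_layered_sentence:
  assumes K: "fact 13 \<le> K"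
  shows "models (alt_group n) (layered_sentence d K)"
proof -
  let ?A = "alt_group n"
  interpret A: group ?A by (rule alt_group_is_group)
  show ?thesis
  proof (cases "n \<ge> 13")
    case True
    have a: "three_cycle 1 2 3 \<in> carrier ?A"
      unfolding alt_group_carrier using True
      by (intro conjI permutes_three_cycle evenperm_three_cycle) auto
    have petals: "petal 1 \<in> carrier ?A" "petal 2 \<in> carrier ?A" "petal 3 \<in> carrier ?A" "petal 4 \<in> carrier ?A"
      using True by (auto intro!: petal_alt_group)
    show ?thesis
      unfolding models_layered_sentence[OF A.one_closed] Let_def
    proof (intro disjI1 allI impI)
      fix g assume "g ` {..<d} \<subseteq> carrier ?A"
      then show "\<exists>a\<in>carrier ?A. \<exists>b1\<in>carrier ?A. \<exists>b2\<in>carrier ?A. \<exists>b3\<in>carrier ?A. \<exists>b4\<in>carrier ?A.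
          \<exists>x0\<in>carrier ?A. \<exists>c\<in>carrier ?A. \<exists>q\<in>carrier ?A. \<exists>r\<in>carrier ?A.
            layered ?A (g ` {..<d}) (stab ?A a [b1, b2, b3, b4])
              (before ?A (stab ?A a [b1, b2, b3, b4]) x0 c q) x0 q r"
        by - (rule bexI[OF _ a], rule bexI[OF _ petals(1)], rule bexI[OF _ petals(2)], rule bexI[OF _ petals(3)], rule bexI[OF _ petals(4)], rule layered_alt_group[OF True])
    qed
  next
    case False
    let ?S = "{p. p permutes {1..n}}"
    have sub: "carrier ?A \<subseteq> ?S" by (auto simp: alt_group_carrier)
    have "finite ?S" by (rule finite_permutations) simp
    have fin: "finite (carrier ?A)" by (rule finite_subset[OF sub]) fact
    have "card (carrier ?A) \<le> card ?S" by (rule card_mono) fact+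
    also have "card ?S = fact n" by (rule card_permutations) simp_all
    also have "fact n \<le> (fact 13 :: nat)" using False by (intro fact_mono) linarith
    also note K
    finally have card: "card (carrier ?A) \<le> K" .
    obtain f where f: "bij_betw f {0..<card (carrier ?A)} (carrier ?A)"
      using ex_bij_betw_nat_finite[OF fin] by blast
    \<comment> \<open>\<open>K\<close> may exceed the order; the surplus indices repeat the
      identity.\<close>
    let ?f = "\<lambda>i. if i < card (carrier ?A) then f i else \<one>\<^bsub>?A\<^esub>"
    have "?f ` {..<K} = carrier ?A"
    proof
      show "?f ` {..<K} \<subseteq> carrier ?A" using f by (auto simp: bij_betw_def)
      show "carrier ?A \<subseteq> ?f ` {..<K}"
      proof
        fix x assume "x \<in> carrier ?A"
        then obtain i where "i \<in> {0..<card (carrier ?A)}" "x = f i"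
          using f unfolding bij_betw_def by blast
        then show "x \<in> ?f ` {..<K}" using card by (intro image_eqI[of _ _ i]) auto
      qed
    qed
    then show ?thesis
      unfolding models_layered_sentence[OF A.one_closed] by blast
  qed
qed

section \<open>Infinite finitely generated groups\<close>

theorem theorem2p1:
  fixes G :: "('a, 'b) monoid_scheme"
    and I :: "'i set"
    and U :: "'i filter"
    and n :: "'i \<Rightarrow> nat"
  assumes "group G"
    and "infinite (carrier G)"
    and "finitely_generated G"
    and "ultrafilter_on I U"
  shows "\<not> elementarily_equivalent G (ultraproduct I U (\<lambda>i. alt_group (n i)))"
proof
  assume equiv: "elementarily_equivalent G (ultraproduct I U (\<lambda>i. alt_group (n i)))"
  interpret group G by fact
  obtain S where S: "finite S" "S \<subseteq> carrier G" "generate G S = carrier G"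
    using assms(3) unfolding finitely_generated_def by blast
  \<comment> \<open>The sentence is taken with one variable for each generator, and its claim about
    all tuples is applied to this enumeration of \<open>S\<close>.\<close>
  obtain g where g: "bij_betw g {0..<card S} S" using ex_bij_betw_nat_finite[OF S(1)] by blast
  then have g_image: "g ` {..<card S} = S" by (simp add: bij_betw_def lessThan_atLeast0)
  define K :: nat where "K = fact 13"
  have "models (ultraproduct I U (\<lambda>i. alt_group (n i))) (layered_sentence (card S) K)"
    using alt_group_is_group assms(4) _ is_sentence_layered_sentence
  proof (rule models_ultraproduct)
    show "models (alt_group (n i)) (layered_sentence (card S) K)" for i
      unfolding K_def by (rule alt_group_models_layered_sentence) (rule order_refl)
  qed
  then have "models G (layered_sentence (card S) K)"
    using equiv is_sentence_layered_sentence unfolding elementarily_equivalent_def by blast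
  then consider
    (layered) a b1 b2 b3 b4 x0 c q r where "x0 \<in> carrier G" "q \<in> carrier G" "r \<in> carrier G"
      "layered G S (stab G a [b1, b2, b3, b4]) (before G (stab G a [b1, b2, b3, b4]) x0 c q) x0 q r"
    | (small) f where "f ` {..<K} = carrier G"
    unfolding models_layered_sentence[OF one_closed] Let_def
    using g_image S(2) by metis
  then have "finite (carrier G)"
  proof cases
    case layered
    show ?thesis
      by (rule layered_imp_finite[OF S stab_subgroup layered])
  next
    case small
    have "finite (f ` {..<K})" by simp
    then show ?thesis unfolding small .
  qed
  with assms(2) show False by contradiction
qed

end
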